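(* Let $d\ge3$, $\kappa,\rho>0$ and $\gamma\in(-\infty,0)$. For $z\in\mathbb{Z}^d$ let $u$ be the solution with localized initial condition $u_0=\delta_z$ and let $M_z(t)=\big\langle\sum_{x\in\mathbb{Z}^d}u(t,x)\big\rangle$. Then for every $z\in\mathbb{Z}^d$, $$\lim_{t\to\infty}M_z(t)=1+\frac{\gamma}{\kappa+\rho-\gamma\,G_1(0)}\,G_1(z).$$
   Context: Parabolic Anderson model with a moving trap: $u\colon[0,\infty)\times\mathbb{Z}^d\to[0,\infty)$ solves $\frac{\partial}{\partial t}u(t,x)=\kappa\Delta u(t,x)+\xi(t,x)u(t,x)$, $u(0,x)=u_0(x)$, where $\Delta f(x)=\sum_{y\in\mathbb{Z}^d:|x-y|=1}[f(y)-f(x)]$ is the discrete Laplacian and $\xi(t,x)=\gamma\,\delta_{Y_t}(x)$ (equal to $\gamma$ if $x=Y_t$ and $0$ otherwise), with $Y$ a continuous-time simple symmetric random walk on $\mathbb{Z}^d$ with generator $\rho\Delta$ started at the origin. $\langle\cdot\rangle$ denotes expectation with respect to $Y$. The solution is given by the Feynman-Kac formula $u(t,x)=\mathbb{E}^X_x\big[\exp\{\gamma\int_0^t\delta_{Y_{t-s}}(X_s)\,ds\}\,u_0(X_t)\big]$, where $X$ is a random walk with generator $\kappa\Delta$ started at $x$, independent of $Y$. $G_1$ is the Green's function of the random walk with generator $\Delta$: $G_1(z)=\int_0^\infty p_t(z)\,dt$, where $p_t(z)$ is the probability that the walk with generator $\Delta$ started at $0$ is at $z$ at time $t$. *)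

theory Defs
  imports "HOL-Probability.Probability"
begin

text \<open>
  The lattice \<open>\<int>\<^sup>d\<close> is the type \<open>int ^ 'd\<close> with \<open>d = CARD('d)\<close>. The relation \<open>|x - y| = 1\<close> is
  expressed with the \<open>\<ell>\<^sup>1\<close> norm; for integer vectors it is the same as for the Euclidean norm.
\<close>

definition lattice_neighbours :: "int ^ 'd \<Rightarrow> (int ^ 'd) set" where
  "lattice_neighbours x = {y. (\<Sum>i\<in>UNIV. \<bar>x $ i - y $ i\<bar>) = 1}"

lemma finite_lattice_neighbours: "finite (lattice_neighbours (x :: int ^ 'd))"
proof -
  let ?B = "\<lambda>i. {x $ i - 1 .. x $ i + 1}"
  have "lattice_neighbours x \<subseteq> vec_lambda ` (Pi\<^sub>E UNIV ?B)"
  proof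
    fix y :: "int ^ 'd" assume y: "y \<in> lattice_neighbours x"
    have "\<bar>x $ i - y $ i\<bar> \<le> 1" for i
      using y member_le_sum[of i UNIV "\<lambda>i. \<bar>x $ i - y $ i\<bar>"]
      by (simp add: lattice_neighbours_def)
    hence "y $ i \<in> ?B i" for i
      by (simp add: abs_le_iff) (metis add.commute diff_le_eq)
    hence "vec_nth y \<in> Pi\<^sub>E UNIV ?B" by auto
    thus "y \<in> vec_lambda ` (Pi\<^sub>E UNIV ?B)"
      by (metis image_eqI vec_nth_inverse)
  qed
  moreover have "finite (Pi\<^sub>E UNIV ?B)" by (intro finite_PiE) auto
  ultimately show ?thesis by (meson finite_imageI finite_subset)
qed

definition lattice_laplacian :: "(int ^ 'd \<Rightarrow> real) \<Rightarrow> int ^ 'd \<Rightarrow> real" where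
  "lattice_laplacian f x = (\<Sum>y\<in>lattice_neighbours x. f y - f x)"

text \<open>
  A random walk on the lattice with generator \<open>c\<Delta>\<close> started at \<open>a\<close>: a process with stationary
  independent increments, whose paths are right-continuous with left limits (in the discrete
  topology, hence piecewise constant with finitely many jumps in bounded time), and whose
  transition semigroup \<open>P\<^sub>t f(x) = E[f(x + Y\<^sub>t - Y\<^sub>0)]\<close> satisfies \<open>(P\<^sub>t f(x) - f(x)) / t \<rightarrow> c \<Delta>f(x)\<close>
  as \<open>t \<down> 0\<close> for bounded \<open>f\<close>. Only times \<open>t \<ge> 0\<close> are relevant.
\<close>

definition lattice_walk ::
    "'w measure \<Rightarrow> real \<Rightarrow> int ^ 'd \<Rightarrow> (real \<Rightarrow> 'w \<Rightarrow> int ^ 'd) \<Rightarrow> bool" where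
  "lattice_walk M c a Y \<longleftrightarrow>
     prob_space M \<and>
     (\<forall>t\<ge>0. Y t \<in> measurable M (count_space UNIV)) \<and>
     (\<forall>\<omega>\<in>space M. Y 0 \<omega> = a) \<and>
     (\<forall>(\<tau> :: nat \<Rightarrow> real) n. 0 \<le> \<tau> 0 \<and> mono \<tau> \<longrightarrow>
        prob_space.indep_vars M (\<lambda>_. count_space UNIV)
          (\<lambda>i \<omega>. Y (\<tau> (Suc i)) \<omega> - Y (\<tau> i) \<omega>) {..<n}) \<and>
     (\<forall>s\<ge>0. \<forall>t\<ge>0. distr M (count_space UNIV) (\<lambda>\<omega>. Y (s + t) \<omega> - Y s \<omega>)
                  = distr M (count_space UNIV) (\<lambda>\<omega>. Y t \<omega> - Y 0 \<omega>)) \<and>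
     (\<forall>\<omega>\<in>space M. \<forall>t\<ge>0. eventually (\<lambda>s. Y s \<omega> = Y t \<omega>) (at_right t)) \<and>
     (\<forall>\<omega>\<in>space M. \<forall>t>0. \<exists>y. eventually (\<lambda>s. Y s \<omega> = y) (at_left t)) \<and>
     (\<forall>f x. bounded (range f) \<longrightarrow>
        ((\<lambda>t. ((\<integral>\<omega>. f (x + (Y t \<omega> - Y 0 \<omega>)) \<partial>M) - f x) / t)
           \<longlongrightarrow> c * lattice_laplacian f x) (at_right 0))"

text \<open>
  The Green's function \<open>\<integral>\<^sub>0\<^sup>\<infinity> P(Z\<^sub>t = z) dt\<close> of a process \<open>Z\<close>; for \<open>Z\<close> a walk with generator \<open>\<Delta>\<close>
  started at the origin this is \<open>G\<^sub>1(z)\<close>, which depends only on the law of \<open>Z\<close>.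
\<close>

definition green_function ::
    "'v measure \<Rightarrow> (real \<Rightarrow> 'v \<Rightarrow> int ^ 'd) \<Rightarrow> int ^ 'd \<Rightarrow> real" where
  "green_function N Z z = (LINT t:{0..}|lborel. measure N {\<omega> \<in> space N. Z t \<omega> = z})"

definition lattice_delta :: "int ^ 'd \<Rightarrow> int ^ 'd \<Rightarrow> real" where
  "lattice_delta y x = (if x = y then 1 else 0)"

text \<open>
  Nonnegative solutions of \<open>\<partial>u/\<partial>t = \<kappa>\<Delta>u + \<xi>u\<close>, \<open>u(0,\<cdot>) = u\<^sub>0\<close> for a potential that is piecewise
  constant in time. At a time where \<open>\<xi>(\<cdot>,x)\<close> jumps, \<open>u(\<cdot>,x)\<close> has in general no two-sided time derivative,
  so there only continuity is required; this determines the same solutions as the integrated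
  equation.
\<close>

definition pam_solution ::
    "real \<Rightarrow> (real \<Rightarrow> int ^ 'd \<Rightarrow> real) \<Rightarrow> (int ^ 'd \<Rightarrow> real) \<Rightarrow> (real \<Rightarrow> int ^ 'd \<Rightarrow> real) \<Rightarrow> bool" where
  "pam_solution \<kappa> \<xi> u0 u \<longleftrightarrow>
     (\<forall>t\<ge>0. \<forall>x. 0 \<le> u t x) \<and>
     (\<forall>x. u 0 x = u0 x) \<and>
     (\<forall>x. continuous_on {0..} (\<lambda>t. u t x)) \<and>
     (\<forall>x. \<forall>t>0. isCont (\<lambda>s. \<xi> s x) t \<longrightarrow>
        ((\<lambda>s. u s x) has_real_derivative
           \<kappa> * lattice_laplacian (u t) x + \<xi> t x * u t x) (at t))"

end

theory Submission
  imports Defs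
begin

text \<open>
  For a fixed path of the trap, Duhamel's formula expresses \<open>u(t,x)\<close> through the heat kernel and
  the mass \<open>a(s) = u(s, Y\<^sub>s)\<close> at the trap, and summing over \<open>x\<close> gives total mass
  \<open>1 + \<gamma> \<integral>\<^sub>0\<^sup>t a(s) ds\<close>. Evaluating at \<open>x = Y\<^sub>t\<close> and averaging, independence of the increments of \<open>Y\<close>
  turns the kernels of rate \<open>\<kappa>\<close> into kernels of rate \<open>\<kappa> + \<rho>\<close>: the mean \<open>g\<close> of \<open>a\<close> satisfies the renewal equation
  \<open>g(t) = p\<^sub>t(z) + \<gamma> \<integral>\<^sub>0\<^sup>t p\<^bsub>t-s\<^esub>(0) g(s) ds\<close> with \<open>p\<close> the heat kernel of rate \<open>\<kappa> + \<rho>\<close>.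
  Integrating it over \<open>t\<close>, which transience in \<open>d \<ge> 3\<close> permits, gives \<open>\<integral> g = G\<^sub>1(z) / (\<kappa> + \<rho> - \<gamma> G\<^sub>1(0))\<close>.
\<close>

section \<open>Sums and integrals\<close>

text \<open>Three obstacles shape the proof. The solution is an arbitrary nonnegative function
  obeying the differential equation, so Feynman-Kac and uniqueness cannot be quoted: Duhamel's
  formula rests on a comparison argument in which \<open>u\<close> dominates finite superpositions
  of heat kernels, which bounds the sums over space and makes the flux cancel. The solution is given
  path by path, so measurability of the trap mass in \<open>\<omega>\<close> and its independence of
  later increments have to be derived, by Picard iteration. Finally, integrability of
  \<open>g\<close> is not known beforehand; as \<gamma> < 0, the interaction term moved to the left
  side is nonnegative, so the equation can be integrated in \<open>ennreal\<close>, where finiteness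
  falls out. The kernel is defined by a Fourier integral. Its equation, its decay and the addition
  of times under averaging are visible there: averaging the kernel of time \<kappa>(t-s) over an
  increment of rate \<rho> adds \<rho>(t-s) to the time. Positivity and mass one come instead from
  identifying the kernel with the law of the increments of the trap.\<close>

text \<open>Translates unconditional lattice sums into integrals over \<open>count_space\<close>,
  where Tonelli exchanges them with time integrals, and back.\<close>

lemma has_sum_iff_nn_integral:
  fixes f :: "'a \<Rightarrow> real"
  assumes "\<And>x. 0 \<le> f x" "0 \<le> S"
  shows "(f has_sum S) UNIV \<longleftrightarrow> (\<integral>\<^sup>+x. ennreal (f x) \<partial>count_space UNIV) = ennreal S"
proof
  assume *: "(f has_sum S) UNIV"
  hence "Infinite_Set_Sum.abs_summable_on f UNIV"
    unfolding abs_summable_equivalent[symmetric] summable_on_iff_abs_summable_on_real[symmetric]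
    by (rule has_sum_imp_summable)
  hence "(\<integral>\<^sup>+x. ennreal (f x) \<partial>count_space UNIV) = ennreal (infsetsum f UNIV)"
    using assms by (simp add: nn_integral_conv_infsetsum)
  also have "infsetsum f UNIV = S"
    using * \<open>Infinite_Set_Sum.abs_summable_on f UNIV\<close> by (metis infsetsum_infsum infsumI)
  finally show "(\<integral>\<^sup>+x. ennreal (f x) \<partial>count_space UNIV) = ennreal S" .
next
  assume *: "(\<integral>\<^sup>+x. ennreal (f x) \<partial>count_space UNIV) = ennreal S"
  hence i: "integrable (count_space UNIV) f"
    using assms by (intro integrableI_bounded) auto
  hence a: "Infinite_Set_Sum.abs_summable_on f UNIV"
    by (simp add: abs_summable_on_altdef set_integrable_def)
  have "infsetsum f UNIV = S"
    using a * assms by (simp add: infsetsum_conv_nn_integral)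
  moreover have "f summable_on UNIV"
    using a unfolding abs_summable_equivalent[symmetric] by (rule abs_summable_summable)
  ultimately show "(f has_sum S) UNIV"
    using a by (metis infsetsum_infsum has_sum_infsum)
qed

lemma integrable_indicator_Icc_bounded:
  fixes f :: "real \<Rightarrow> real"
  assumes "f \<in> borel_measurable borel" "\<And>t. a \<le> t \<Longrightarrow> t \<le> b \<Longrightarrow> \<bar>f t\<bar> \<le> B"
  shows "integrable lborel (\<lambda>t. indicator {a..b} t * f t)"
  using integrableI_bounded_set_indicator[of "{a..b}" lborel f B] assms by (simp add: emeasure_lborel_Icc_eq)

text \<open>One induction step of the factorial bound in \<open>picard_error\<close>.\<close>

lemma integral_power_interval:
  fixes t c :: real
  assumes "0 \<le> t"
  shows "(\<integral>s. indicator {0..t} s * ((c * s) ^ n / fact n) \<partial>lborel) * c = (c * t) ^ Suc n / fact (Suc n)"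
proof -
  have "(\<integral>s. indicator {0..t} s * ((c * s) ^ n / fact n) \<partial>lborel) = (\<integral>s. c ^ n / fact n * (s ^ n * indicator {0..t} s) \<partial>lborel)"
    by (simp add: power_mult_distrib mult_ac)
  also have "\<dots> = c ^ n / fact n * (t ^ Suc n / Suc n)"
    using integral_power[OF assms, of n] by (simp del: of_nat_Suc)
  finally show ?thesis by (simp add: power_mult_distrib field_simps del: of_nat_Suc)
qed

lemma power_over_fact_le_exp: "0 \<le> x \<Longrightarrow> x ^ n / fact n \<le> exp (x :: real)"
  using sum_le_suminf[OF summable_exp, of "{n}" x]
  by (simp add: exp_def divide_inverse scaleR_conv_of_real mult.commute)

lemma power_over_fact_tendsto_0: "(\<lambda>n. (x :: real) ^ n / fact n) \<longlonglongrightarrow> 0"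
  by (rule summable_LIMSEQ_zero) (use summable_exp[of x] in \<open>simp add: divide_inverse mult.commute\<close>)

section \<open>Lattice sums\<close>

text \<open>Integer entries whose absolute values sum to 1 vanish except for a single one, which is
  1 or -1.\<close>

lemma lattice_neighbours_eq:
  "lattice_neighbours x = range (\<lambda>i. x + axis i 1) \<union> range (\<lambda>i. x - axis i (1::int))"
proof (intro subset_antisym subsetI)
  fix y assume "y \<in> lattice_neighbours x"
  hence s: "(\<Sum>i\<in>UNIV. \<bar>x $ i - y $ i\<bar>) = 1" by (simp add: lattice_neighbours_def)
  then obtain i where i: "x $ i \<noteq> y $ i"
    by (metis (mono_tags, lifting) abs_0 diff_self sum.neutral zero_neq_one)
  have split: "\<bar>x $ i - y $ i\<bar> + (\<Sum>j\<in>UNIV-{i}. \<bar>x $ j - y $ j\<bar>) = 1"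
    using s by (subst (asm) sum.remove[of _ i]) auto
  have nn: "0 \<le> (\<Sum>j\<in>UNIV-{i}. \<bar>x $ j - y $ j\<bar>)" by (simp add: sum_nonneg)
  have di: "\<bar>x $ i - y $ i\<bar> = 1" using split nn i by linarith
  hence "(\<Sum>j\<in>UNIV-{i}. \<bar>x $ j - y $ j\<bar>) = 0" using split by simp
  hence rest: "y $ j = x $ j" if "j \<noteq> i" for j
    using that by (subst (asm) sum_nonneg_eq_0_iff) auto
  consider "y $ i = x $ i + 1" | "y $ i = x $ i - 1" using di by linarith
  thus "y \<in> range (\<lambda>i. x + axis i 1) \<union> range (\<lambda>i. x - axis i 1)"
  proof cases
    case 1
    hence "y = x + axis i 1" using rest by (auto simp: vec_eq_iff axis_def)
    thus ?thesis by auto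
  next
    case 2
    hence "y = x - axis i 1" using rest by (auto simp: vec_eq_iff axis_def)
    thus ?thesis by auto
  qed
next
  fix y assume "y \<in> range (\<lambda>i. x + axis i 1) \<union> range (\<lambda>i. x - axis i 1)"
  then obtain i where "y = x + axis i 1 \<or> y = x - axis i 1" by auto
  hence "(\<Sum>j\<in>UNIV. \<bar>x $ j - y $ j\<bar>) = (\<Sum>j\<in>UNIV. if j = i then 1 else 0)"
    by (intro sum.cong) (auto simp: axis_def)
  thus "y \<in> lattice_neighbours x" by (simp add: lattice_neighbours_def)
qed

lemma sum_lattice_neighbours:
  fixes x :: "int ^ 'd" and f :: "int ^ 'd \<Rightarrow> real"
  shows "sum f (lattice_neighbours x) = (\<Sum>i\<in>UNIV. f (x + axis i 1) + f (x - axis i 1))"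
proof -
  have inj: "inj (\<lambda>i::'d. axis i (1::int))" by (auto simp: inj_on_def axis_eq_axis)
  have disj: "x + axis i (1::int) \<noteq> x - axis j 1" for i j :: 'd
  proof
    assume "x + axis i (1::int) = x - axis j 1"
    hence "(x + axis i (1::int)) $ i = (x - axis j 1) $ i" by simp
    thus False by (auto simp: axis_def split: if_splits)
  qed
  have "sum f (lattice_neighbours x)
      = sum f (range (\<lambda>i. x + axis i 1)) + sum f (range (\<lambda>i. x - axis i 1))"
    unfolding lattice_neighbours_eq by (rule sum.union_disjoint) (use disj in auto)
  also have "sum f (range (\<lambda>i. x + axis i 1)) = (\<Sum>i\<in>UNIV. f (x + axis i 1))"
    by (subst sum.reindex) (use inj in \<open>auto simp: inj_on_def\<close>)
  also have "sum f (range (\<lambda>i. x - axis i 1)) = (\<Sum>i\<in>UNIV. f (x - axis i 1))"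
    by (subst sum.reindex) (use inj in \<open>auto simp: inj_on_def\<close>)
  finally show ?thesis by (simp add: sum.distrib)
qed

lemma lattice_laplacian_eq:
  "lattice_laplacian f x = (\<Sum>i\<in>UNIV. f (x + axis i 1) + f (x - axis i 1) - 2 * f x)"
  unfolding lattice_laplacian_def sum_lattice_neighbours
  by (intro sum.cong) auto

section \<open>The heat kernel on the lattice\<close>

text \<open>Normalized Haar measure of the dual group of the integers, realized on an interval.
  Total mass one absorbs the factor 1/(2 pi) of Fourier inversion and makes the d-fold product a
  probability measure.\<close>

definition circle_measure :: "real measure" where
  "circle_measure = uniform_measure lborel {-pi..pi}"

lemma sets_circle_measure [measurable_cong, simp]: "sets circle_measure = sets borel"
  by (simp add: circle_measure_def)

lemma space_circle_measure [simp]: "space circle_measure = UNIV"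
  by (simp add: circle_measure_def)

lemma prob_space_circle_measure: "prob_space circle_measure"
  unfolding circle_measure_def by (rule prob_space_uniform_measure) auto

interpretation circle: prob_space circle_measure
  by (rule prob_space_circle_measure)

lemma integral_circle_measure:
  fixes f :: "real \<Rightarrow> real"
  assumes "continuous_on UNIV f"
  shows "(\<integral>x. f x \<partial>circle_measure) = integral {-pi..pi} f / (2 * pi)"
proof -
  have [measurable]: "f \<in> borel_measurable borel"
    using assms by (rule borel_measurable_continuous_onI)
  have m: "emeasure lborel {- pi..pi} = ennreal (2 * pi)" by (simp)
  have d: "indicator {- pi..pi} x / emeasure lborel {- pi..pi} = ennreal (indicator {- pi..pi} x / (2 * pi))"
    for x :: real unfolding m by (auto simp: indicator_def divide_ennreal ennreal_1[symmetric] simp del: ennreal_1)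
  have "circle_measure = density lborel (\<lambda>x. ennreal (indicator {- pi..pi} x / (2 * pi)))"
    unfolding circle_measure_def uniform_measure_def d ..
  hence "(\<integral>x. f x \<partial>circle_measure)
      = (\<integral>x. f x \<partial>density lborel (\<lambda>x. ennreal (indicator {- pi..pi} x / (2 * pi))))"
    by (rule arg_cong)
  also have "\<dots> = (\<integral>x. (indicator {- pi..pi} x / (2 * pi)) * f x \<partial>lborel)"
    by (subst integral_density) auto
  also have "\<dots> = (\<integral>x. indicator {- pi..pi} x * f x \<partial>lborel) / (2 * pi)"
    by (subst integral_divide_zero[symmetric]) (simp add: mult_ac)
  also have "(\<integral>x. indicator {- pi..pi} x * f x \<partial>lborel) = (LINT x:{-pi..pi}|lborel. f x)"
    by (simp add: set_lebesgue_integral_def)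
  also have "\<dots> = integral {-pi..pi} f"
    by (intro set_borel_integral_eq_integral borel_integrable_atLeastAtMost')
       (use assms continuous_on_subset in blast)
  finally show ?thesis .
qed

lemma integrable_circle_continuous:
  fixes f :: "real \<Rightarrow> 'a :: {banach, second_countable_topology}"
  assumes "f \<in> borel_measurable borel" "\<And>x. norm (f x) \<le> B"
  shows "integrable circle_measure f"
  by (rule circle.integrable_const_bound[where B=B]) (use assms in auto)

text \<open>Fourier inversion of the characteristic function exp(-2t(1 - cos \<theta>)) of the
  one-dimensional walk that jumps at rate 1 to each side; the sine part drops out by symmetry. The
  formula makes sense for negative \<open>t\<close> too, so time derivatives at 0 are
  two-sided.\<close>

definition heat1 :: "real \<Rightarrow> int \<Rightarrow> real" where
  "heat1 t k = (\<integral>\<theta>. cos (of_int k * \<theta>) * exp (- (2 * t * (1 - cos \<theta>))) \<partial>circle_measure)"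

lemma heat1_eq: "heat1 t k = integral {-pi..pi} (\<lambda>\<theta>. cos (of_int k * \<theta>) * exp (- (2 * t * (1 - cos \<theta>)))) / (2 * pi)"
  unfolding heat1_def by (intro integral_circle_measure continuous_intros)

lemma exp_cos_le: "exp (- (2 * t * (1 - cos \<theta>))) \<le> exp (4 * \<bar>t\<bar>)" for t \<theta> :: real
proof -
  have "\<bar>2 * t * (1 - cos \<theta>)\<bar> \<le> 2 * \<bar>t\<bar> * 2"
    unfolding abs_mult using cos_le_one[of \<theta>] cos_ge_minus_one[of \<theta>]
    by (intro mult_mono) auto
  thus ?thesis by simp
qed

lemma integrable_heat1:
  "integrable circle_measure (\<lambda>\<theta>. cos (of_int k * \<theta>) * exp (- (2 * t * (1 - cos \<theta>))))"
proof (rule integrable_circle_continuous[where B="exp (4 * \<bar>t\<bar>)"])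
  fix \<theta> :: real
  have "\<bar>cos (of_int k * \<theta>)\<bar> * exp (- (2 * t * (1 - cos \<theta>))) \<le> 1 * exp (4 * \<bar>t\<bar>)"
    by (rule mult_mono) (use exp_cos_le in auto)
  thus "norm (cos (of_int k * \<theta>) * exp (- (2 * t * (1 - cos \<theta>)))) \<le> exp (4 * \<bar>t\<bar>)"
    by (simp add: abs_mult)
qed simp

lemma heat1_minus [simp]: "heat1 t (- k) = heat1 t k"
  by (simp add: heat1_def)

text \<open>The cosine only shrinks a positive weight. This bounds the kernel while its sign is
  still unknown.\<close>

lemma heat1_bound: "\<bar>heat1 t k\<bar> \<le> heat1 t 0"
proof -
  have "\<bar>heat1 t k\<bar> \<le> (\<integral>\<theta>. \<bar>cos (of_int k * \<theta>) * exp (- (2 * t * (1 - cos \<theta>)))\<bar> \<partial>circle_measure)"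
    unfolding heat1_def by (rule integral_abs_bound)
  also have "\<dots> \<le> heat1 t 0"
    unfolding heat1_def
  proof (rule integral_mono)
    show "integrable circle_measure (\<lambda>\<theta>. \<bar>cos (of_int k * \<theta>) * exp (- (2 * t * (1 - cos \<theta>)))\<bar>)"
      by (rule integrable_abs[OF integrable_heat1])
    show "\<bar>cos (of_int k * \<theta>) * exp (- (2 * t * (1 - cos \<theta>)))\<bar>
        \<le> cos (of_int 0 * \<theta>) * exp (- (2 * t * (1 - cos \<theta>)))" for \<theta>
      by (simp add: abs_mult mult_left_le_one_le)
  qed (rule integrable_heat1)
  finally show ?thesis .
qed

lemma heat1_0_le_1: assumes "t \<ge> 0" shows "heat1 t 0 \<le> 1"
proof -
  have "heat1 t 0 \<le> (\<integral>\<theta>. 1 \<partial>circle_measure)"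
    unfolding heat1_def using assms
    by (intro integral_mono integrable_heat1) auto
  thus ?thesis using circle.prob_space by simp
qed

lemma heat1_at_0: "heat1 0 k = (if k = 0 then 1 else 0)"
proof (cases "k = 0")
  case True
  thus ?thesis using circle.prob_space by (simp add: heat1_def)
next
  case False
  have "((\<lambda>\<theta>. cos (of_int k * \<theta>)) has_integral
      (sin (of_int k * pi) / of_int k - sin (of_int k * (-pi)) / of_int k)) {-pi..pi}"
    using False
    by (intro fundamental_theorem_of_calculus)
       (auto intro!: derivative_eq_intros simp: has_real_derivative_iff_has_vector_derivative[symmetric])
  moreover have "sin (of_int k * pi) = 0" by (auto simp: sin_zero_iff_int2)
  ultimately have "integral {-pi..pi} (\<lambda>\<theta>. cos (of_int k * \<theta>)) = 0"
    by (intro integral_unique) simp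
  thus ?thesis using False by (simp add: heat1_eq)
qed

text \<open>Differentiation under the integral produces the factor -2(1 - cos \<theta>), and 2 cos
  \<theta> cos(k\<theta>) = cos((k+1)\<theta>) + cos((k-1)\<theta>) turns it into a second
  difference in \<open>k\<close>.\<close>

lemma DERIV_heat1:
  "((\<lambda>t. heat1 t k) has_real_derivative heat1 t (k + 1) + heat1 t (k - 1) - 2 * heat1 t k) (at t)"
proof -
  let ?f = "\<lambda>t \<theta>. cos (of_int k * \<theta>) * exp (- (2 * t * (1 - cos \<theta>)))"
  let ?f' = "\<lambda>t \<theta>. cos (of_int k * \<theta>) * (exp (- (2 * t * (1 - cos \<theta>))) * (- (2 * (1 - cos \<theta>))))"
  have "((\<lambda>t. integral (cbox (-pi) pi) (?f t)) has_field_derivative integral (cbox (-pi) pi) (?f' t)) (at t within UNIV)"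
    by (rule leibniz_rule_field_derivative)
       (auto intro!: derivative_eq_intros continuous_intros integrable_continuous_real simp: split_beta)
  hence d: "((\<lambda>t. heat1 t k) has_field_derivative integral {-pi..pi} (?f' t) / (2 * pi)) (at t)"
    unfolding heat1_eq by (intro DERIV_cdivide) simp
  have "integral {-pi..pi} (?f' t) / (2 * pi) = (\<integral>\<theta>. ?f' t \<theta> \<partial>circle_measure)"
    by (intro integral_circle_measure[symmetric] continuous_intros)
  also have "\<dots> = (\<integral>\<theta>. cos (of_int (k+1) * \<theta>) * exp (- (2 * t * (1 - cos \<theta>)))
      + cos (of_int (k-1) * \<theta>) * exp (- (2 * t * (1 - cos \<theta>))) - 2 * ?f t \<theta> \<partial>circle_measure)"
    by (intro Bochner_Integration.integral_cong refl)
       (simp add: algebra_simps cos_add cos_diff)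
  also have "\<dots> = heat1 t (k + 1) + heat1 t (k - 1) - 2 * heat1 t k"
    using integrable_heat1[of "k + 1" t] integrable_heat1[of "k - 1" t] integrable_heat1[of k t]
    unfolding heat1_def by simp
  finally show ?thesis using d by simp
qed

text \<open>The Laplacian is a sum over coordinates, so the coordinates of the walk evolve as
  independent one-dimensional walks and the kernel factorizes.\<close>

definition heat_kernel :: "real \<Rightarrow> int ^ 'd \<Rightarrow> real" where
  "heat_kernel t x = (\<Prod>i\<in>UNIV. heat1 t (x $ i))"

lemma heat_kernel_minus [simp]: "heat_kernel t (- x) = heat_kernel t x"
  by (simp add: heat_kernel_def)

lemma heat_kernel_commute: "heat_kernel t (x - y) = heat_kernel t (y - x)"
  using heat_kernel_minus[of t "x - y"] by simp

lemma heat_kernel_at_0: "heat_kernel 0 x = (if x = 0 then 1 else 0)"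
  by (auto simp: heat_kernel_def heat1_at_0 vec_eq_iff)

lemma heat_kernel_bound: "\<bar>heat_kernel t x\<bar> \<le> heat_kernel t (0 :: int ^ 'd)" for x :: "int ^ 'd"
  unfolding heat_kernel_def abs_prod zero_index
  by (rule prod_mono) (use heat1_bound in auto)

lemma heat1_0_nonneg: "0 \<le> heat1 t 0"
  by (simp add: heat1_def)

lemma heat_kernel_0_le_1: assumes "t \<ge> 0" shows "heat_kernel t 0 \<le> 1"
  unfolding heat_kernel_def
  by (rule prod_le_1) (use heat1_0_nonneg heat1_0_le_1[OF assms] in auto)

lemma abs_heat_kernel_le_1: "t \<ge> 0 \<Longrightarrow> \<bar>heat_kernel t x\<bar> \<le> 1"
  using heat_kernel_bound heat_kernel_0_le_1 order.trans by blast

text \<open>The term of the product rule that differentiates factor \<open>i\<close> is the second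
  difference of the kernel in direction \<open>i\<close>.\<close>

lemma DERIV_heat_kernel:
  "((\<lambda>t. heat_kernel t x) has_real_derivative lattice_laplacian (heat_kernel t) x) (at t)"
proof -
  have upd: "(\<Prod>j\<in>UNIV. heat1 t ((x + axis i a) $ j)) = heat1 t (x $ i + a) * (\<Prod>j\<in>UNIV-{i}. heat1 t (x $ j))" for i a
    by (subst prod.remove[of _ i]) (auto simp: axis_def)
  have upd': "(\<Prod>j\<in>UNIV. heat1 t ((x - axis i a) $ j)) = heat1 t (x $ i - a) * (\<Prod>j\<in>UNIV-{i}. heat1 t (x $ j))" for i a
    by (subst prod.remove[of _ i]) (auto simp: axis_def)
  have "((\<lambda>t. heat_kernel t x) has_real_derivative
     (\<Sum>i\<in>UNIV. (heat1 t (x $ i + 1) + heat1 t (x $ i - 1) - 2 * heat1 t (x $ i)) * (\<Prod>j\<in>UNIV-{i}. heat1 t (x $ j)))) (at t)"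
    unfolding heat_kernel_def by (rule has_field_derivative_prod) (rule DERIV_heat1)
  also have "(\<Sum>i\<in>UNIV. (heat1 t (x $ i + 1) + heat1 t (x $ i - 1) - 2 * heat1 t (x $ i)) * (\<Prod>j\<in>UNIV-{i}. heat1 t (x $ j)))
     = lattice_laplacian (heat_kernel t) x"
    unfolding lattice_laplacian_eq
  proof (intro sum.cong refl)
    fix i :: 'a
    have "heat_kernel t x = heat1 t (x $ i) * (\<Prod>j\<in>UNIV-{i}. heat1 t (x $ j))"
      unfolding heat_kernel_def by (subst prod.remove[of _ i]) auto
    thus "(heat1 t (x $ i + 1) + heat1 t (x $ i - 1) - 2 * heat1 t (x $ i)) * (\<Prod>j\<in>UNIV-{i}. heat1 t (x $ j)) =
      heat_kernel t (x + axis i 1) + heat_kernel t (x - axis i 1) - 2 * heat_kernel t x"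
      using upd[of i 1] upd'[of i 1] by (simp add: heat_kernel_def[of t "x + _"] heat_kernel_def[of t "x - _"] algebra_simps)
  qed
  finally show ?thesis .
qed

lemma continuous_on_heat_kernel [continuous_intros]:
  assumes "continuous_on S f" shows "continuous_on S (\<lambda>s. heat_kernel (f s) x)"
proof -
  have "continuous_on UNIV (\<lambda>t. heat_kernel t x)"
    using DERIV_heat_kernel DERIV_isCont by (blast intro: continuous_at_imp_continuous_on)
  from continuous_on_compose2[OF this assms] show ?thesis by simp
qed

lemma borel_measurable_heat_kernel [measurable]: "(\<lambda>t. heat_kernel t x) \<in> borel_measurable borel"
  by (intro borel_measurable_continuous_onI continuous_intros)

section \<open>Decay of the heat kernel in time\<close>

lemma one_minus_cos_ge:
  fixes x :: real
  assumes "\<bar>x\<bar> \<le> pi" shows "1 - cos x \<ge> x\<^sup>2 / 16"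
proof -
  obtain t where t: "cos x = (\<Sum>m<4. cos_coeff m * x ^ m) + cos (t + 1/2 * real (4::nat) * pi) / fact 4 * x ^ 4"
    using Maclaurin_cos_expansion[of x 4] by blast
  have s: "(\<Sum>m<4. cos_coeff m * x ^ m) = 1 - x\<^sup>2 / 2"
    by (simp add: lessThan_nat_numeral lessThan_Suc cos_coeff_def fact_numeral)
  have "cos (t + 1/2 * real (4::nat) * pi) / fact 4 * x ^ 4 \<le> 1 / fact 4 * x ^ 4"
    by (intro mult_right_mono divide_right_mono) auto
  hence c: "cos x \<le> 1 - x\<^sup>2 / 2 + x ^ 4 / 24"
    unfolding t s by (simp add: fact_numeral)
  have "x\<^sup>2 \<le> pi\<^sup>2" using assms by (simp add: abs_le_square_iff[symmetric])
  also have "\<dots> \<le> 3.2\<^sup>2" using pi_approx by (intro power_mono) auto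
  \<comment> \<open>Since 3.2 squared is at most 10.5, the Taylor bound leaves the coefficient 1/2 -
    10.5/24 = 1/16; this is the origin of the 16.\<close>
  finally have "x\<^sup>2 * x\<^sup>2 \<le> 10.5 * x\<^sup>2"
    by (intro mult_right_mono) (auto simp: power2_eq_square)
  thus ?thesis using c by (simp add: power2_eq_square power4_eq_xxxx)
qed

lemma heat1_decay: assumes "t > 0" shows "heat1 t 0 \<le> 2 / sqrt t"
proof -
  \<comment> \<open>Chosen so that the exponent 2t * \<theta>^2/16 obtained from
    \<open>one_minus_cos_ge\<close> equals \<theta>^2/(2\<sigma>^2), the exponent of a centred
    normal density.\<close>
  define \<sigma> where "\<sigma> = 2 / sqrt t"
  have \<sigma>: "\<sigma> > 0" using assms by (simp add: \<sigma>_def)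
  have \<sigma>2: "\<sigma>\<^sup>2 = 4 / t" using assms by (simp add: \<sigma>_def power_divide)
  have le: "exp (- (2 * t * (1 - cos \<theta>))) \<le> sqrt (2 * pi * \<sigma>\<^sup>2) * normal_density 0 \<sigma> \<theta>"
    if "\<theta> \<in> {-pi..pi}" for \<theta>
  proof -
    have "t * (\<theta>\<^sup>2 / 16) \<le> t * (1 - cos \<theta>)"
      using that assms by (intro mult_left_mono one_minus_cos_ge) auto
    hence "exp (- (2 * t * (1 - cos \<theta>))) \<le> exp (- (\<theta>\<^sup>2 / (2 * \<sigma>\<^sup>2)))"
      using assms by (simp add: \<sigma>2 field_simps)
    thus ?thesis using \<sigma> by (simp add: normal_density_def)
  qed
  have "heat1 t 0 = integral {-pi..pi} (\<lambda>\<theta>. exp (- (2 * t * (1 - cos \<theta>)))) / (2 * pi)"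
    by (simp add: heat1_eq)
  also have "integral {-pi..pi} (\<lambda>\<theta>. exp (- (2 * t * (1 - cos \<theta>))))
      = (LINT \<theta>:{-pi..pi}|lborel. exp (- (2 * t * (1 - cos \<theta>))))"
    by (intro set_borel_integral_eq_integral(2)[symmetric] borel_integrable_atLeastAtMost' continuous_intros)
  also have "\<dots> \<le> (\<integral>\<theta>. sqrt (2 * pi * \<sigma>\<^sup>2) * normal_density 0 \<sigma> \<theta> \<partial>lborel)"
    unfolding set_lebesgue_integral_def
  proof (rule integral_mono)
    show "integrable lborel (\<lambda>\<theta>. indicat_real {- pi..pi} \<theta> *\<^sub>R exp (- (2 * t * (1 - cos \<theta>))))"
      using borel_integrable_atLeastAtMost'[of "-pi" pi "\<lambda>\<theta>. exp (- (2 * t * (1 - cos \<theta>)))"]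
      by (simp add: set_integrable_def continuous_intros)
    show "integrable lborel (\<lambda>\<theta>. sqrt (2 * pi * \<sigma>\<^sup>2) * normal_density 0 \<sigma> \<theta>)"
      using \<sigma> by (intro integrable_mult_right integrable_normal_density)
    show "indicat_real {- pi..pi} \<theta> *\<^sub>R exp (- (2 * t * (1 - cos \<theta>)))
        \<le> sqrt (2 * pi * \<sigma>\<^sup>2) * normal_density 0 \<sigma> \<theta>" for \<theta>
      using le[of \<theta>] by (auto simp: indicator_def)
  qed
  also have "\<dots> = sqrt (2 * pi) * \<sigma>"
    using \<sigma> by (simp add: real_sqrt_mult)
  also have "sqrt (2 * pi) * \<sigma> / (2 * pi) \<le> \<sigma>"
  proof -
    have "sqrt (2 * pi) \<le> sqrt ((2 * pi)\<^sup>2)"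
      using pi_gt3 by (intro real_sqrt_le_mono self_le_power) auto
    also have "\<dots> = 2 * pi" using pi_gt_zero by (subst real_sqrt_abs) simp
    finally show ?thesis using \<sigma> by (simp add: field_simps)
  qed
  finally show ?thesis using \<sigma> by (simp add: \<sigma>_def divide_right_mono)
qed

section \<open>Fourier analysis of lattice walks\<close>

lemma borel_measurable_cis [measurable (raw)]:
  "f \<in> borel_measurable M \<Longrightarrow> (\<lambda>x. cis (f x)) \<in> borel_measurable M"
  by (rule measurable_compose[of f M borel cis]) (auto intro!: borel_measurable_continuous_onI continuous_intros)

lemma measurable_vec_nth_count_space [measurable (raw)]:
  assumes "f \<in> measurable M (count_space UNIV)"
  shows "(\<lambda>\<omega>. f \<omega> $ i) \<in> measurable M (count_space UNIV)"
  by (rule measurable_compose[OF assms]) simp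

lemma borel_measurable_real_of_int [measurable (raw)]:
  assumes "f \<in> measurable M (count_space UNIV)"
  shows "(\<lambda>\<omega>. real_of_int (f \<omega>)) \<in> borel_measurable M"
  by (rule measurable_compose[OF assms]) simp

text \<open>The added imaginary part is odd in \<theta> and integrates to 0. Unlike the cosine,
  \<open>cis\<close> is multiplicative, which lets averages over a random displacement factor out of
  the integrand.\<close>

lemma complex_of_real_heat1:
  "complex_of_real (heat1 t k)
     = (\<integral>\<theta>. cis (of_int k * \<theta>) * of_real (exp (- (2 * t * (1 - cos \<theta>)))) \<partial>circle_measure)"
  (is "_ = integral\<^sup>L _ ?f")
proof -
  have int: "integrable circle_measure ?f"
    by (rule integrable_circle_continuous[where B="exp (4 * \<bar>t\<bar>)"])
       (use exp_cos_le in \<open>auto simp: norm_mult\<close>)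
  let ?g = "\<lambda>\<theta>. sin (of_int k * \<theta>) * exp (- (2 * t * (1 - cos \<theta>)))"
  have "integral {-pi..pi} ?g = integral {-pi..pi} (\<lambda>\<theta>. ?g (-\<theta>))"
    using Henstock_Kurzweil_Integration.integral_reflect_real[of pi "-pi" ?g] by (simp only: minus_minus)
  also have "\<dots> = - integral {-pi..pi} ?g"
    by (simp only: cos_minus mult_minus_right sin_minus mult_minus_left Henstock_Kurzweil_Integration.integral_neg)
  finally have "integral {-pi..pi} ?g = 0" by linarith
  moreover have "(\<integral>\<theta>. ?g \<theta> \<partial>circle_measure) = integral {-pi..pi} ?g / (2 * pi)"
    by (intro integral_circle_measure continuous_intros)
  ultimately have im: "(\<integral>\<theta>. ?g \<theta> \<partial>circle_measure) = 0" by simp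
  show ?thesis
  proof (rule complex_eqI)
    show "Re (complex_of_real (heat1 t k)) = Re (integral\<^sup>L circle_measure ?f)"
      by (subst integral_Re[OF int, symmetric]) (simp add: heat1_def)
    show "Im (complex_of_real (heat1 t k)) = Im (integral\<^sup>L circle_measure ?f)"
      by (subst integral_Im[OF int, symmetric]) (simp add: im)
  qed
qed

lemma complex_of_real_heat_kernel:
  fixes x :: "int ^ 'd"
  shows "complex_of_real (heat_kernel t x) =
    (\<integral>\<theta>. (\<Prod>i\<in>UNIV. cis (of_int (x $ i) * \<theta> i) * of_real (exp (- (2 * t * (1 - cos (\<theta> i)))))) \<partial>PiM UNIV (\<lambda>_. circle_measure))"
proof -
  interpret product_sigma_finite "\<lambda>_ :: 'd. circle_measure"
    by (rule product_sigma_finite.intro) (rule circle.sigma_finite_measure_axioms)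
  show ?thesis
    unfolding heat_kernel_def of_real_prod complex_of_real_heat1
    by (intro product_integral_prod[symmetric] finite integrable_circle_continuous[where B="exp (4 * \<bar>t\<bar>)"])
       (use exp_cos_le in \<open>auto simp: norm_mult\<close>)
qed

text \<open>On the Fourier side, averaging over \<open>V\<close> multiplies the integrand by the
  characteristic function of \<open>V\<close>, and the exponents \<open>s\<close> and
  \<open>c\<close> add. This replaces a semigroup identity with convolution sums.\<close>

lemma expectation_heat_kernel:
  fixes V :: "'w \<Rightarrow> int ^ 'd" and x :: "int ^ 'd"
  assumes "prob_space M" and V [measurable]: "V \<in> measurable M (count_space UNIV)"
    and char: "\<And>\<theta> :: 'd \<Rightarrow> real. (\<integral>\<omega>. (\<Prod>i\<in>UNIV. cis (of_int (V \<omega> $ i) * \<theta> i)) \<partial>M)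
                 = (\<Prod>i\<in>UNIV. of_real (exp (- (2 * c * (1 - cos (\<theta> i))))))"
  shows "(\<integral>\<omega>. heat_kernel s (x + V \<omega>) \<partial>M) = heat_kernel (s + c) x"
proof -
  interpret prob_space M by fact
  let ?P = "PiM UNIV (\<lambda>_ :: 'd. circle_measure)"
  interpret P: product_prob_space "\<lambda>_ :: 'd. circle_measure" UNIV
    by (rule product_prob_space.intro)
       (auto intro!: product_prob_space_axioms.intro product_sigma_finite.intro
          circle.sigma_finite_measure_axioms prob_space_circle_measure)
  interpret P: prob_space ?P by (rule P.prob_space_axioms)
  interpret MP: pair_prob_space M ?P ..
  let ?w = "\<lambda>t \<theta>. \<Prod>i\<in>UNIV. complex_of_real (exp (- (2 * t * (1 - cos (\<theta> i :: real)))))"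
  let ?f = "\<lambda>\<omega> \<theta>. \<Prod>i\<in>UNIV. cis (of_int ((x + V \<omega>) $ i) * \<theta> i) * complex_of_real (exp (- (2 * s * (1 - cos (\<theta> i)))))"
  have Vm: "(\<lambda>\<omega>. x + V \<omega>) \<in> measurable M (count_space UNIV)"
    by (rule measurable_compose[OF V]) simp
  have int: "integrable (M \<Otimes>\<^sub>M ?P) (case_prod ?f)"
  proof (rule MP.integrable_const_bound[where B="\<Prod>i\<in>(UNIV::'d set). exp (4 * \<bar>s\<bar>)"])
    show "AE z in M \<Otimes>\<^sub>M ?P. cmod (case_prod ?f z) \<le> (\<Prod>i\<in>(UNIV::'d set). exp (4 * \<bar>s\<bar>))"
      by (intro AE_I2, unfold case_prod_beta prod_norm[symmetric] norm_mult, intro prod_mono)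
         (use exp_cos_le in \<open>auto simp: norm_mult\<close>)
    have [measurable]: "(\<lambda>z. real_of_int ((x + V (fst z)) $ i)) \<in> borel_measurable (M \<Otimes>\<^sub>M ?P)" for i
      using Vm by measurable
    have [measurable]: "(\<lambda>z. snd z i) \<in> borel_measurable (M \<Otimes>\<^sub>M ?P)" for i :: 'd
      by (rule measurable_compose[OF measurable_snd])
         (use measurable_component_singleton[of i UNIV "\<lambda>_. circle_measure"] in \<open>simp cong: measurable_cong_sets\<close>)
    show "case_prod ?f \<in> borel_measurable (M \<Otimes>\<^sub>M ?P)"
      unfolding case_prod_beta by measurable
  qed
  have "complex_of_real (\<integral>\<omega>. heat_kernel s (x + V \<omega>) \<partial>M) = (\<integral>\<omega>. complex_of_real (heat_kernel s (x + V \<omega>)) \<partial>M)"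
    by (rule integral_complex_of_real[symmetric])
  also have "\<dots> = (\<integral>\<omega>. (\<integral>\<theta>. ?f \<omega> \<theta> \<partial>?P) \<partial>M)"
    unfolding complex_of_real_heat_kernel ..
  also have "\<dots> = (\<integral>\<theta>. (\<integral>\<omega>. ?f \<omega> \<theta> \<partial>M) \<partial>?P)"
    by (rule MP.Fubini_integral[OF int, symmetric])
  also have "\<dots> = (\<integral>\<theta>. (\<Prod>i\<in>UNIV. cis (of_int (x $ i) * \<theta> i) * complex_of_real (exp (- (2 * (s + c) * (1 - cos (\<theta> i)))))) \<partial>?P)"
  proof (intro Bochner_Integration.integral_cong refl)
    fix \<theta> :: "'d \<Rightarrow> real"
    have "?f \<omega> \<theta> = (\<Prod>i\<in>UNIV. cis (of_int (x $ i) * \<theta> i)) * ?w s \<theta> * (\<Prod>i\<in>UNIV. cis (of_int (V \<omega> $ i) * \<theta> i))" for \<omega>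
      by (simp add: cis_mult[symmetric] distrib_left distrib_right mult_ac prod.distrib)
    hence "(\<integral>\<omega>. ?f \<omega> \<theta> \<partial>M) = (\<Prod>i\<in>UNIV. cis (of_int (x $ i) * \<theta> i)) * (?w s \<theta> * ?w c \<theta>)"
      by (simp add: char mult.assoc)
    also have "?w s \<theta> * ?w c \<theta> = ?w (s + c) \<theta>"
      by (simp add: prod.distrib[symmetric] of_real_mult[symmetric] exp_add[symmetric] algebra_simps)
    finally show "(\<integral>\<omega>. ?f \<omega> \<theta> \<partial>M) = (\<Prod>i\<in>UNIV. cis (of_int (x $ i) * \<theta> i) * complex_of_real (exp (- (2 * (s + c) * (1 - cos (\<theta> i))))))"
      by (simp add: prod.distrib mult.assoc)
  qed
  also have "\<dots> = complex_of_real (heat_kernel (s + c) x)"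
    unfolding complex_of_real_heat_kernel ..
  finally show ?thesis by (simp only: of_real_eq_iff)
qed

section \<open>Integrability of the kernel in time\<close>

lemma integrable_heat_kernel_0:
  assumes d: "CARD('d) \<ge> 3" and c: "c > 0"
  shows "set_integrable lborel {0..} (\<lambda>t. heat_kernel (c * t) (0 :: int ^ 'd))"
proof -
  let ?f = "\<lambda>t. heat_kernel (c * t) (0 :: int ^ 'd)"
  have nn: "0 \<le> ?f t" for t by (auto simp: heat_kernel_def heat1_0_nonneg intro: prod_nonneg)
  let ?C = "8 / (c * sqrt c)"
  have le: "?f t \<le> ?C * t powr (-3/2)" if "t \<ge> 1" for t
  proof -
    have "?f t = heat1 (c * t) 0 ^ CARD('d)" by (simp add: heat_kernel_def)
    also have "\<dots> \<le> heat1 (c * t) 0 ^ 3"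
      \<comment> \<open>The dimension enters here: \<open>heat1\<close> at 0 lies in [0, 1], so the
        power d may be lowered to 3, and the decay t^(-1/2) per coordinate gives the integrable
        t^(-3/2).\<close>
      using d that c by (intro power_decreasing heat1_0_nonneg heat1_0_le_1) auto
    also have "\<dots> \<le> (2 / sqrt (c * t)) ^ 3"
      using that c by (intro power_mono heat1_decay heat1_0_nonneg) auto
    also have "\<dots> = ?C * (1 / (t * sqrt t))"
      using that c by (simp add: power3_eq_cube real_sqrt_mult power_divide) (simp add: field_simps)
    also have "t * sqrt t = t powr (3/2)"
      using that powr_add[of t 1 "1/2"] by (simp add: powr_half_sqrt)
    also have "1 / t powr (3/2) = t powr (-3/2)"
      by (simp add: powr_minus_divide)
    finally show ?thesis .
  qed
  have "((\<lambda>t. t powr (-3/2)) has_integral - (1 powr (-3/2 + 1)) / (-3/2 + 1)) {1::real..}"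
    by (rule has_integral_powr_to_inf) auto
  hence "(\<lambda>t. t powr (-3/2)) absolutely_integrable_on {1::real..}"
    by (intro nonnegative_absolutely_integrable_1) auto
  hence "set_integrable lborel {1..} (\<lambda>t::real. t powr (-3/2))"
    unfolding absolutely_integrable_on_def[symmetric]
    by (simp add: set_integrable_def integrable_completion)
  hence "set_integrable lborel {1..} (\<lambda>t. ?C * t powr (-3/2))"
    by (rule set_integrable_mult_right)
  hence 1: "set_integrable lborel {1..} ?f"
    by (rule set_integrable_bound) (use le nn c in \<open>auto simp: set_borel_measurable_def abs_of_pos\<close>)
  have 2: "set_integrable lborel {0..1} ?f"
    by (intro borel_integrable_atLeastAtMost' continuous_intros)
  have "{0..} = {0..1} \<union> {1::real..}" by auto
  thus ?thesis using set_integrable_Un[OF 2 1] by simp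
qed

lemma integrable_heat_kernel:
  assumes d: "CARD('d) \<ge> 3" and c: "c > 0"
  shows "set_integrable lborel {0..} (\<lambda>t. heat_kernel (c * t) (x :: int ^ 'd))"
proof (rule set_integrable_bound[OF integrable_heat_kernel_0[OF d c]])
  show "set_borel_measurable lborel {0..} (\<lambda>t. heat_kernel (c * t) x)"
    by (simp add: set_borel_measurable_def)
  show "AE t in lborel. t \<in> {0..} \<longrightarrow> norm (heat_kernel (c * t) x) \<le> norm (heat_kernel (c * t) (0 :: int ^ 'd))"
    using heat_kernel_bound by (auto intro: order.trans[OF _ abs_ge_self])
qed

text \<open>Substitution t -> ct: the walk of rate \<open>c\<close> is the walk of rate 1 run at
  speed \<open>c\<close>, hence its Green's function is divided by \<open>c\<close>.\<close>

lemma integral_heat_kernel_scale: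
  assumes c: "c > 0"
  shows "(LINT t:{0..}|lborel. heat_kernel (c * t) x) = (LINT t:{0..}|lborel. heat_kernel t x) / c"
proof -
  have "(LINT t:{0..}|lborel. heat_kernel t x)
      = \<bar>c\<bar> *\<^sub>R (\<integral>t. indicator {0..} (0 + c * t) *\<^sub>R heat_kernel (0 + c * t) x \<partial>lborel)"
    unfolding set_lebesgue_integral_def using c by (intro lborel_integral_real_affine) auto
  also have "(\<lambda>t. indicator {0..} (0 + c * t) :: real) = indicator {0..}"
    using c by (auto simp: indicator_def zero_le_mult_iff fun_eq_iff)
  finally show ?thesis using c by (simp add: set_lebesgue_integral_def)
qed

section \<open>Characteristic function and law of a walk\<close>

locale lattice_random_walk = prob_space M for M :: "'w measure" +
  fixes c :: real and a :: "int ^ 'd" and Y :: "real \<Rightarrow> 'w \<Rightarrow> int ^ 'd"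
  assumes walk: "lattice_walk M c a Y"
begin

lemma measurable_walk: "t \<ge> 0 \<Longrightarrow> Y t \<in> measurable M (count_space UNIV)"
  using walk by (auto simp: lattice_walk_def)

lemma walk_start: "\<omega> \<in> space M \<Longrightarrow> Y 0 \<omega> = a"
  using walk by (auto simp: lattice_walk_def)

lemma measurable_increment: 
  assumes "s \<ge> 0" "t \<ge> 0" shows "(\<lambda>\<omega>. Y t \<omega> - Y s \<omega>) \<in> measurable M (count_space UNIV)"
proof -
  have "(\<lambda>\<omega>. (Y t \<omega>, Y s \<omega>)) \<in> measurable M (count_space UNIV \<Otimes>\<^sub>M count_space UNIV)"
    by (intro measurable_Pair measurable_walk assms)
  hence "(\<lambda>\<omega>. (Y t \<omega>, Y s \<omega>)) \<in> measurable M (count_space UNIV)"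
    by (subst (asm) pair_measure_countable) auto
  from measurable_compose[OF this, of "\<lambda>(x, y). x - y" "count_space UNIV"] show ?thesis by simp
qed

lemma measurable_increment_fun:
  assumes "s \<ge> 0" "t \<ge> 0" "range f \<subseteq> space N"
  shows "(\<lambda>\<omega>. f (Y t \<omega> - Y s \<omega>)) \<in> measurable M N"
  by (rule measurable_compose[OF measurable_increment]) (use assms in auto)

text \<open>Stated for values in a normed field to serve both the complex characters in
  \<open>char_walk_add\<close> and the real kernels in
  \<open>expectation_picard_future\<close>.\<close>

lemma expectation_prod_increments:
  fixes f :: "nat \<Rightarrow> int ^ 'd \<Rightarrow> 'b :: {real_normed_field, banach, second_countable_topology}"
  assumes \<tau>: "0 \<le> \<tau> 0" "mono \<tau>" and B: "\<And>i x. i < n \<Longrightarrow> norm (f i x) \<le> B"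
  shows "(\<integral>\<omega>. (\<Prod>i<n. f i (Y (\<tau> (Suc i)) \<omega> - Y (\<tau> i) \<omega>)) \<partial>M)
       = (\<Prod>i<n. \<integral>\<omega>. f i (Y (\<tau> (Suc i)) \<omega> - Y (\<tau> i) \<omega>) \<partial>M)"
proof (rule indep_vars_lebesgue_integral)
  have nn: "0 \<le> \<tau> i" for i using \<tau> by (meson le0 monoD order.trans)
  have "indep_vars (\<lambda>_. count_space UNIV) (\<lambda>i \<omega>. Y (\<tau> (Suc i)) \<omega> - Y (\<tau> i) \<omega>) {..<n}"
    using walk \<tau> by (auto simp: lattice_walk_def)
  from indep_vars_compose2[OF this, of f "\<lambda>_. borel"]
  show "indep_vars (\<lambda>_. borel) (\<lambda>i \<omega>. f i (Y (\<tau> (Suc i)) \<omega> - Y (\<tau> i) \<omega>)) {..<n}"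
    by simp
  show "integrable M (\<lambda>\<omega>. f i (Y (\<tau> (Suc i)) \<omega> - Y (\<tau> i) \<omega>))" if "i \<in> {..<n}" for i
    by (rule integrable_const_bound[where B=B])
       (use B that nn in \<open>auto intro!: measurable_increment_fun\<close>)
qed simp

lemma expectation_stationary:
  fixes f :: "int ^ 'd \<Rightarrow> 'b :: {banach, second_countable_topology}"
  assumes "0 \<le> s" "0 \<le> t"
  shows "(\<integral>\<omega>. f (Y (s + t) \<omega> - Y s \<omega>) \<partial>M) = (\<integral>\<omega>. f (Y t \<omega> - Y 0 \<omega>) \<partial>M)"
proof -
  have "distr M (count_space UNIV) (\<lambda>\<omega>. Y (s + t) \<omega> - Y s \<omega>)
      = distr M (count_space UNIV) (\<lambda>\<omega>. Y t \<omega> - Y 0 \<omega>)"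
    using walk assms by (auto simp: lattice_walk_def)
  hence "integral\<^sup>L (distr M (count_space UNIV) (\<lambda>\<omega>. Y (s + t) \<omega> - Y s \<omega>)) f
      = integral\<^sup>L (distr M (count_space UNIV) (\<lambda>\<omega>. Y t \<omega> - Y 0 \<omega>)) f"
    by simp
  thus ?thesis
    by (simp add: integral_distr measurable_increment assms)
qed

definition char_walk :: "('d \<Rightarrow> real) \<Rightarrow> real \<Rightarrow> complex" where
  "char_walk \<theta> t = (\<integral>\<omega>. cis (\<Sum>i\<in>UNIV. of_int ((Y t \<omega> - Y 0 \<omega>) $ i) * \<theta> i) \<partial>M)"

lemma norm_char_walk: "norm (char_walk \<theta> t) \<le> 1"
proof -
  have "norm (char_walk \<theta> t) \<le> (\<integral>\<omega>. norm (cis (\<Sum>i\<in>UNIV. of_int ((Y t \<omega> - Y 0 \<omega>) $ i) * \<theta> i)) \<partial>M)"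
    unfolding char_walk_def by (rule integral_norm_bound)
  thus ?thesis by (simp add: prob_space)
qed

lemma char_walk_add:
  assumes "0 \<le> s" "0 \<le> t"
  shows "char_walk \<theta> (s + t) = char_walk \<theta> s * char_walk \<theta> t"
proof -
  let ?e = "\<lambda>x :: int ^ 'd. cis (\<Sum>i\<in>UNIV. of_int (x $ i) * \<theta> i)"
  \<comment> \<open>The times 0, s, s+t, continued constantly because \<open>lattice_walk\<close>
    asks for a monotone sequence on all of \<open>nat\<close>.\<close>
  define \<tau> where "\<tau> n = (if n = 0 then 0 else if n = Suc 0 then s else s + t)" for n :: nat
  have mono: "mono \<tau>" using assms by (auto simp: mono_def \<tau>_def)
  have add: "?e (x + y) = ?e x * ?e y" for x y
    by (simp add: cis_mult distrib_right sum.distrib)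
  have "char_walk \<theta> (s + t) = (\<integral>\<omega>. ?e ((Y s \<omega> - Y 0 \<omega>) + (Y (s + t) \<omega> - Y s \<omega>)) \<partial>M)"
    by (simp add: char_walk_def)
  also have "\<dots> = (\<integral>\<omega>. (\<Prod>i<2. ?e (Y (\<tau> (Suc i)) \<omega> - Y (\<tau> i) \<omega>)) \<partial>M)"
    unfolding add by (simp add: \<tau>_def numeral_2_eq_2 lessThan_Suc mult.commute)
  also have "\<dots> = (\<Prod>i<2. \<integral>\<omega>. ?e (Y (\<tau> (Suc i)) \<omega> - Y (\<tau> i) \<omega>) \<partial>M)"
    by (rule expectation_prod_increments[where B=1]) (use mono in \<open>simp_all add: \<tau>_def[of 0]\<close>)
  also have "\<dots> = char_walk \<theta> s * (\<integral>\<omega>. ?e (Y (s + t) \<omega> - Y s \<omega>) \<partial>M)"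
    by (simp add: \<tau>_def numeral_2_eq_2 lessThan_Suc char_walk_def mult.commute)
  also have "(\<integral>\<omega>. ?e (Y (s + t) \<omega> - Y s \<omega>) \<partial>M) = char_walk \<theta> t"
    unfolding char_walk_def using assms by (rule expectation_stationary)
  finally show ?thesis .
qed

lemma char_walk_0: "char_walk \<theta> 0 = 1"
  by (simp add: char_walk_def prob_space)

lemma char_walk_power:
  assumes "0 \<le> t" shows "char_walk \<theta> (of_nat n * t) = char_walk \<theta> t ^ n"
  by (induction n) (use assms in \<open>auto simp: char_walk_0 distrib_right char_walk_add\<close>)

lemma tendsto_generator:
  assumes "bounded (range f)"
  shows "((\<lambda>t. ((\<integral>\<omega>. f (x + (Y t \<omega> - Y 0 \<omega>)) \<partial>M) - f x) / t)
           \<longlongrightarrow> c * lattice_laplacian f x) (at_right 0)"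
  using walk assms unfolding lattice_walk_def by blast

text \<open>The Fourier symbol of the negative lattice Laplacian.\<close>

definition char_exponent :: "('d \<Rightarrow> real) \<Rightarrow> real" where
  "char_exponent \<theta> = (\<Sum>i\<in>UNIV. 2 * (1 - cos (\<theta> i)))"

text \<open>The generator condition speaks of real functions, so it is applied at the origin to the
  cosine and sine of the phase separately; oddness makes the Laplacian of the sine vanish
  there.\<close>

lemma tendsto_char_walk:
  "((\<lambda>t. (char_walk \<theta> t - 1) / of_real t) \<longlongrightarrow> of_real (- c * char_exponent \<theta>)) (at_right 0)"
proof -
  let ?C = "\<lambda>x :: int ^ 'd. cos (\<Sum>i\<in>UNIV. of_int (x $ i) * \<theta> i)"
  let ?S = "\<lambda>x :: int ^ 'd. sin (\<Sum>i\<in>UNIV. of_int (x $ i) * \<theta> i)"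
  have ax: "(\<Sum>i\<in>UNIV. of_int (axis j 1 $ i) * \<theta> i) = \<theta> j" for j
  proof -
    have "(\<Sum>i\<in>UNIV. of_int (axis j 1 $ i) * \<theta> i) = (\<Sum>i\<in>UNIV. if i = j then \<theta> i else 0)"
      by (intro sum.cong) (auto simp: axis_def)
    thus ?thesis by simp
  qed
  have axm: "(\<Sum>i\<in>UNIV. of_int ((- axis j 1) $ i) * \<theta> i) = - \<theta> j" for j
    using ax[of j] by (simp add: sum_negf)
  have LC: "lattice_laplacian ?C 0 = - char_exponent \<theta>"
    unfolding lattice_laplacian_eq char_exponent_def sum_negf[symmetric]
  proof (intro sum.cong refl)
    fix j show "?C (0 + axis j 1) + ?C (0 - axis j 1) - 2 * ?C 0 = - (2 * (1 - cos (\<theta> j)))"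
      using ax[of j] axm[of j] by (simp del: vector_uminus_component)
  qed
  have LS: "lattice_laplacian ?S 0 = 0"
    unfolding lattice_laplacian_eq
  proof (intro sum.neutral ballI)
    fix j show "?S (0 + axis j 1) + ?S (0 - axis j 1) - 2 * ?S 0 = 0"
      using ax[of j] axm[of j] by (simp del: vector_uminus_component)
  qed
  have bC: "bounded (range ?C)" by (intro boundedI[where B=1]) auto
  have bS: "bounded (range ?S)" by (intro boundedI[where B=1]) auto
  have lim: "((\<lambda>t. Complex (((\<integral>\<omega>. ?C (0 + (Y t \<omega> - Y 0 \<omega>)) \<partial>M) - ?C 0) / t) (((\<integral>\<omega>. ?S (0 + (Y t \<omega> - Y 0 \<omega>)) \<partial>M) - ?S 0) / t))
      \<longlongrightarrow> Complex (c * lattice_laplacian ?C 0) (c * lattice_laplacian ?S 0)) (at_right 0)"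
    by (intro tendsto_Complex tendsto_generator bC bS)
  have eq: "Complex (((\<integral>\<omega>. ?C (0 + (Y t \<omega> - Y 0 \<omega>)) \<partial>M) - ?C 0) / t) (((\<integral>\<omega>. ?S (0 + (Y t \<omega> - Y 0 \<omega>)) \<partial>M) - ?S 0) / t)
      = (char_walk \<theta> t - 1) / of_real t" if "t > 0" for t
  proof -
    have int: "integrable M (\<lambda>\<omega>. cis (\<Sum>i\<in>UNIV. of_int ((Y t \<omega> - Y 0 \<omega>) $ i) * \<theta> i))"
      by (rule integrable_const_bound[where B=1])
         (use that in \<open>auto intro!: measurable_increment_fun[where f="\<lambda>x. cis (\<Sum>i\<in>UNIV. of_int (x $ i) * \<theta> i)"] simp del: vector_minus_component\<close>)
    have "Re (char_walk \<theta> t) = (\<integral>\<omega>. ?C (Y t \<omega> - Y 0 \<omega>) \<partial>M)"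
      "Im (char_walk \<theta> t) = (\<integral>\<omega>. ?S (Y t \<omega> - Y 0 \<omega>) \<partial>M)"
      unfolding char_walk_def
      by (simp_all only: integral_Re[OF int, symmetric] integral_Im[OF int, symmetric] cis.sel)
    thus ?thesis
      by (intro complex_eqI) (simp_all add: Re_divide_of_real Im_divide_of_real del: vector_minus_component)
  qed
  have "((\<lambda>t. (char_walk \<theta> t - 1) / of_real t) \<longlongrightarrow> Complex (c * lattice_laplacian ?C 0) (c * lattice_laplacian ?S 0)) (at_right 0)"
    by (rule Lim_transform_eventually[OF lim eventually_mono[OF eventually_at_right_less eq]])
  thus ?thesis by (simp add: LC LS complex_of_real_def)
qed

text \<open>Only the derivative at 0 is known. Split [0, t] into n+1 equal steps: both sides are
  (n+1)-st powers of numbers of modulus at most 1 (for the exponential because c \<ge> 0), so their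
  distance is at most n+1 times the distance over one step, which is o(1/n) since the two
  derivatives at 0 agree.\<close>

lemma char_walk_eq:
  assumes c: "c \<ge> 0" and t: "0 \<le> t"
  shows "char_walk \<theta> t = of_real (exp (- c * char_exponent \<theta> * t))"
proof (cases "t = 0")
  case True
  thus ?thesis by (simp add: char_walk_0)
next
  case False
  define l where "l = - c * char_exponent \<theta>"
  have l: "l \<le> 0" using c by (auto simp: l_def char_exponent_def intro!: mult_nonneg_nonneg sum_nonneg)
  let ?e = "\<lambda>h. complex_of_real (exp (l * h))"
  have "((\<lambda>h. exp (l * h)) has_real_derivative l) (at 0)"
    by (auto intro!: derivative_eq_intros)
  hence "((\<lambda>h. (exp (l * h) - 1) / h) \<longlongrightarrow> l) (at 0)"
    by (simp add: DERIV_def)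
  hence "((\<lambda>h. (exp (l * h) - 1) / h) \<longlongrightarrow> l) (at_right 0)"
    by (rule tendsto_mono[OF at_le, rotated]) auto
  hence "((\<lambda>h. complex_of_real ((exp (l * h) - 1) / h)) \<longlongrightarrow> of_real l) (at_right 0)"
    by (rule tendsto_of_real)
  with tendsto_char_walk[of \<theta>]
  have "((\<lambda>h. (char_walk \<theta> h - 1) / of_real h - complex_of_real ((exp (l * h) - 1) / h)) \<longlongrightarrow> of_real l - of_real l) (at_right 0)"
    unfolding l_def by (rule tendsto_diff)
  hence D: "((\<lambda>h. (char_walk \<theta> h - ?e h) / of_real h) \<longlongrightarrow> 0) (at_right 0)"
    by (simp add: diff_divide_distrib)
  have "filterlim (\<lambda>n. t / real (Suc n)) (at_right 0) sequentially"
    using False t LIMSEQ_Suc[OF lim_const_over_n[of t]]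
    by (auto simp: filterlim_at intro!: always_eventually)
  from filterlim_compose[OF D this]
  have "(\<lambda>n. norm ((char_walk \<theta> (t / Suc n) - ?e (t / Suc n)) / of_real (t / Suc n))) \<longlonglongrightarrow> 0"
    by (rule tendsto_norm_zero)
  hence lim: "(\<lambda>n. t * norm ((char_walk \<theta> (t / Suc n) - ?e (t / Suc n)) / of_real (t / Suc n))) \<longlonglongrightarrow> 0"
    by (rule tendsto_mult_right_zero)
  have "norm (char_walk \<theta> t - ?e t) \<le> t * norm ((char_walk \<theta> (t / Suc n) - ?e (t / Suc n)) / of_real (t / Suc n))" for n
  proof -
    have "char_walk \<theta> t = char_walk \<theta> (t / Suc n) ^ Suc n"
      using char_walk_power[of "t / Suc n" \<theta> "Suc n"] t by simp
    moreover have "?e t = ?e (t / Suc n) ^ Suc n"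
      by (simp only: of_real_power[symmetric] exp_of_nat_mult[symmetric]) (simp add: field_simps)
    moreover have "norm (?e (t / Suc n)) \<le> 1"
      using l t by (simp add: mult_nonpos_nonneg divide_nonpos_pos)
    ultimately have "norm (char_walk \<theta> t - ?e t) \<le> Suc n * norm (char_walk \<theta> (t / Suc n) - ?e (t / Suc n))"
      using norm_power_diff[OF norm_char_walk[of \<theta> "t / Suc n"], of "?e (t / Suc n)" "Suc n"] by metis
    also have "\<dots> = t * norm ((char_walk \<theta> (t / Suc n) - ?e (t / Suc n)) / of_real (t / Suc n))"
    proof -
      have "norm (complex_of_real (t / Suc n)) = t / Suc n"
        using t by (simp del: of_real_divide of_nat_Suc)
      thus ?thesis
        using False t by (simp only: norm_divide) (simp del: of_nat_Suc)
    qed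
    finally show ?thesis .
  qed
  from LIMSEQ_le_const[OF lim, of "norm (char_walk \<theta> t - ?e t)"] this
  have "norm (char_walk \<theta> t - ?e t) \<le> 0" by blast
  thus ?thesis by (simp add: l_def)
qed

text \<open>With \<open>r = \<kappa> * (t - s)\<close> and \<open>c = \<rho>\<close> this is the
  passage from rate \<kappa> to rate \<kappa> + \<rho>.\<close>

theorem expectation_heat_kernel_walk:
  assumes c: "c \<ge> 0" and "0 \<le> s" "s \<le> t"
  shows "(\<integral>\<omega>. heat_kernel r (x + (Y t \<omega> - Y s \<omega>)) \<partial>M) = heat_kernel (r + c * (t - s)) x"
proof -
  have "(\<integral>\<omega>. heat_kernel r (x + (Y t \<omega> - Y s \<omega>)) \<partial>M) = (\<integral>\<omega>. heat_kernel r (x + (Y (t - s) \<omega> - Y 0 \<omega>)) \<partial>M)"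
    using expectation_stationary[of s "t - s" "\<lambda>y. heat_kernel r (x + y)"] assms by simp
  also have "\<dots> = heat_kernel (r + c * (t - s)) x"
  proof (rule expectation_heat_kernel)
    show "prob_space M" by (rule prob_space_axioms)
    show "(\<lambda>\<omega>. Y (t - s) \<omega> - Y 0 \<omega>) \<in> measurable M (count_space UNIV)"
      using assms by (intro measurable_increment) auto
    fix \<theta> :: "'d \<Rightarrow> real"
    have p: "(\<Prod>i\<in>A. cis (f i)) = cis (\<Sum>i\<in>A. f i)" if "finite A" for A and f :: "'d \<Rightarrow> real"
      using that by (induction A) (auto simp: cis_mult)
    have e: "(\<Prod>i\<in>UNIV. of_real (exp (- (2 * (c * (t - s)) * (1 - cos (\<theta> i))))))
        = complex_of_real (exp (- c * char_exponent \<theta> * (t - s)))"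
      unfolding of_real_prod[symmetric] exp_sum[OF finite, symmetric] char_exponent_def
      by (simp add: sum_distrib_left sum_distrib_right sum_negf algebra_simps)
    show "(\<integral>\<omega>. (\<Prod>i\<in>UNIV. cis (of_int ((Y (t - s) \<omega> - Y 0 \<omega>) $ i) * \<theta> i)) \<partial>M)
        = (\<Prod>i\<in>UNIV. of_real (exp (- (2 * (c * (t - s)) * (1 - cos (\<theta> i))))))"
      using char_walk_eq[of "t - s" \<theta>] assms unfolding e p[OF finite] by (simp add: char_walk_def)
  qed
  finally show ?thesis .
qed

text \<open>The kernel at time 0 is the indicator of the origin, so the probability is the average
  of a kernel with \<open>r = 0\<close>.\<close>

lemma prob_increment:
  assumes c: "c \<ge> 0" and "0 \<le> s" "s \<le> t"
  shows "measure M {\<omega> \<in> space M. Y t \<omega> - Y s \<omega> = x} = heat_kernel (c * (t - s)) x"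
proof -
  have [measurable]: "(\<lambda>\<omega>. Y t \<omega> - Y s \<omega>) \<in> measurable M (count_space UNIV)"
    using assms by (intro measurable_increment) auto
  have "measure M {\<omega> \<in> space M. Y t \<omega> - Y s \<omega> = x}
      = (\<integral>\<omega>. indicator {\<omega> \<in> space M. Y t \<omega> - Y s \<omega> = x} \<omega> \<partial>M)"
    by simp
  also have "\<dots> = (\<integral>\<omega>. heat_kernel 0 (- x + (Y t \<omega> - Y s \<omega>)) \<partial>M)"
    by (intro Bochner_Integration.integral_cong refl) (auto simp: heat_kernel_at_0 indicator_def)
  also have "\<dots> = heat_kernel (c * (t - s)) x"
    using expectation_heat_kernel_walk[OF assms, of 0 "-x"] by simp
  finally show ?thesis .
qed

text \<open>The oscillating Fourier integral hides the sign; it is read off from the kernel being a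
  probability for the walk at time \<open>t / c\<close>.\<close>

lemma heat_kernel_nonneg: 
  assumes c: "c > 0" and "t \<ge> 0" shows "heat_kernel t (x :: int ^ 'd) \<ge> 0"
  using prob_increment[of 0 "t / c" x] assms measure_nonneg[of M "{\<omega> \<in> space M. Y (t / c) \<omega> - Y 0 \<omega> = x}"]
  by simp

text \<open>The kernel lists the point masses of the law of an increment, a probability measure on a
  countable set.\<close>

lemma has_sum_heat_kernel:
  assumes c: "c > 0" and t: "t \<ge> 0" shows "((heat_kernel t :: int ^ 'd \<Rightarrow> real) has_sum 1) UNIV"
proof -
  let ?V = "\<lambda>\<omega>. Y (t / c) \<omega> - Y 0 \<omega>"
  have V: "?V \<in> measurable M (count_space UNIV)"
    using c t by (intro measurable_increment) auto
  have eq: "emeasure (distr M (count_space UNIV) ?V) {x} = ennreal (heat_kernel t x)" for x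
  proof -
    have "?V -` {x} \<inter> space M = {\<omega> \<in> space M. ?V \<omega> = x}" by auto
    thus ?thesis
      using prob_increment[of 0 "t / c" x] c t by (simp add: emeasure_distr[OF V] emeasure_eq_measure)
  qed
  have "(\<integral>\<^sup>+x. ennreal (heat_kernel t (x :: int ^ 'd)) \<partial>count_space UNIV)
      = emeasure (distr M (count_space UNIV) ?V) UNIV"
    by (subst emeasure_countable_singleton) (auto simp: eq)
  also have "\<dots> = ennreal 1"
    using emeasure_space_1 by (simp add: emeasure_distr[OF V])
  finally show ?thesis
    by (subst has_sum_iff_nn_integral) (use heat_kernel_nonneg[OF c t] in auto)
qed

end

lemma green_function_eq:
  assumes "lattice_walk N 1 0 Z"
  shows "green_function N Z z = (LINT t:{0..}|lborel. heat_kernel t z)"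
proof -
  interpret prob_space N using assms by (simp add: lattice_walk_def)
  interpret lattice_random_walk N 1 0 Z by unfold_locales fact
  have "measure N {\<omega> \<in> space N. Z t \<omega> = z} = heat_kernel t z" if "t \<ge> 0" for t
  proof -
    have "{\<omega> \<in> space N. Z t \<omega> = z} = {\<omega> \<in> space N. Z t \<omega> - Z 0 \<omega> = z}"
      using walk_start by auto
    thus ?thesis using prob_increment[of 0 t z] that by simp
  qed
  thus ?thesis
    unfolding green_function_def by (intro set_lebesgue_integral_cong) auto
qed

section \<open>Piecewise constant paths\<close>

text \<open>One-sided limits in the discrete topology make the path constant on an interval on
  either side of each time, so jump times cannot accumulate, and a compact interval contains
  finitely many.\<close>

lemma finite_jumps:
  fixes y :: "real \<Rightarrow> 'a"
  assumes right: "\<And>t. t \<ge> 0 \<Longrightarrow> eventually (\<lambda>s. y s = y t) (at_right t)"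
    and left: "\<And>t. t > 0 \<Longrightarrow> \<exists>v. eventually (\<lambda>s. y s = v) (at_left t)"
  shows "finite ({0..T} \<inter> {t. 0 < t \<and> \<not> eventually (\<lambda>s. y s = y t) (at t)})"
proof (rule finite_not_islimpt_in_compact)
  show "compact {0..T}" by simp
  fix t assume "t \<in> {0..T}"
  hence t: "t \<ge> 0" by simp
  let ?J = "{t. 0 < t \<and> \<not> eventually (\<lambda>s. y s = y t) (at t)}"
  have interval: "s \<notin> ?J" if "s \<in> {l<..<r}" "\<forall>x\<in>{l<..<r}. y x = v" for s l r v
  proof -
    have "eventually (\<lambda>x. x \<in> {l<..<r}) (at s)"
      using that(1) by (intro eventually_at_in_open') auto
    hence "eventually (\<lambda>x. y x = y s) (at s)"
      using that by (auto elim!: eventually_mono)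
    thus ?thesis by simp
  qed
  obtain b where b: "b > t" "\<forall>x>t. x < b \<longrightarrow> y x = y t"
    using right[OF t] by (auto simp: eventually_at_right_field)
  have R: "eventually (\<lambda>s. s \<notin> ?J) (at_right t)"
    using b interval[of _ t b "y t"] by (auto simp: eventually_at_right_field intro!: exI[of _ b])
  have L: "eventually (\<lambda>s. s \<notin> ?J) (at_left t)"
  proof (cases "t = 0")
    case True
    thus ?thesis by (auto simp: eventually_at_left_field intro!: exI[of _ "-1"])
  next
    case False
    then obtain v where "eventually (\<lambda>s. y s = v) (at_left t)" using left t by force
    then obtain l where l: "l < t" "\<forall>x>l. x < t \<longrightarrow> y x = v"
      by (auto simp: eventually_at_left_field)
    thus ?thesis
      using interval[of _ l t v] by (auto simp: eventually_at_left_field intro!: exI[of _ l])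
  qed
  show "\<not> t islimpt ?J"
    using L R by (simp add: islimpt_iff_eventually eventually_at_split)
qed

text \<open>Time is rounded to a grid point strictly to its right. The rounded process takes
  countably many times and is measurable, and by right-constancy it eventually equals the process
  itself.\<close>

lemma measurable_right_constant_process:
  fixes Y :: "real \<Rightarrow> 'w \<Rightarrow> 'a :: countable"
  assumes Y: "\<And>t. t \<ge> 0 \<Longrightarrow> Y t \<in> measurable M (count_space UNIV)"
    and right: "\<And>\<omega> t. \<omega> \<in> space M \<Longrightarrow> t \<ge> 0 \<Longrightarrow> eventually (\<lambda>s. Y s \<omega> = Y t \<omega>) (at_right t)"
  shows "(\<lambda>(t, \<omega>). Y (max 0 t) \<omega>) \<in> measurable (borel \<Otimes>\<^sub>M M) (count_space UNIV)"
proof -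
  let ?B = "borel \<Otimes>\<^sub>M M :: (real \<times> 'w) measure"
  \<comment> \<open>The \<open>+ 1\<close> keeps the grid point strictly above
    \<open>max 0 t\<close>, as convergence along \<open>at_right\<close> demands.\<close>
  define s where "s n t = (of_int \<lfloor>real (Suc n) * max 0 t\<rfloor> + 1) / real (Suc n)" for n and t :: real
  have meas [measurable]: "(\<lambda>p. Y (s n (fst p)) (snd p)) \<in> measurable ?B (count_space UNIV)" for n
  proof -
    \<comment> \<open>Measurability is demanded for every integer index; \<open>max 0 i\<close>
      sends the negative ones to times at which \<open>Y\<close> is measurable.\<close>
    have "(\<lambda>p. (\<lambda>i p. Y ((of_int (max 0 i) + 1) / real (Suc n)) (snd p)) \<lfloor>real (Suc n) * max 0 (fst p)\<rfloor> p)
        \<in> measurable ?B (count_space UNIV)"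
      by (rule measurable_compose_countable) (auto intro!: measurable_compose[OF measurable_snd Y])
    also have "(\<lambda>p. (\<lambda>i p. Y ((of_int (max 0 i) + 1) / real (Suc n)) (snd p)) \<lfloor>real (Suc n) * max 0 (fst p)\<rfloor> p)
       = (\<lambda>p. Y (s n (fst p)) (snd p))"
      by (auto simp: s_def fun_eq_iff max_def)
    finally show ?thesis .
  qed
  have s_gt: "max 0 t < s n t" for n t
  proof -
    have "max 0 t * real (Suc n) < of_int \<lfloor>real (Suc n) * max 0 t\<rfloor> + 1"
      unfolding mult.commute[of "max 0 t"] by linarith
    thus ?thesis unfolding s_def by (subst pos_less_divide_eq) auto
  qed
  have s_le: "s n t \<le> max 0 t + 1 / real (Suc n)" for n t
  proof -
    have "of_int \<lfloor>real (Suc n) * max 0 t\<rfloor> + 1 \<le> (max 0 t + 1 / real (Suc n)) * real (Suc n)"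
      by (simp add: distrib_right mult.commute[of "max 0 t"] del: of_nat_Suc)
    thus ?thesis unfolding s_def by (subst pos_divide_le_eq) auto
  qed
  have s_lim: "(\<lambda>n. s n t) \<longlonglongrightarrow> max 0 t" for t
  proof (rule tendsto_sandwich[where f="\<lambda>_. max 0 t"])
    show "(\<lambda>n. max 0 t + 1 / real (Suc n)) \<longlonglongrightarrow> max 0 t"
      using tendsto_add[OF tendsto_const LIMSEQ_Suc[OF lim_const_over_n[of 1]], of "max 0 t"] by simp
    show "eventually (\<lambda>n. max 0 t \<le> s n t) sequentially"
      by (intro always_eventually allI less_imp_le s_gt)
    show "eventually (\<lambda>n. s n t \<le> max 0 t + 1 / real (Suc n)) sequentially"
      by (intro always_eventually allI s_le)
  qed simp
  have "filterlim (\<lambda>n. s n t) (at_right (max 0 t)) sequentially" for t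
    unfolding filterlim_at greaterThan_iff
    by (intro conjI always_eventually allI s_lim s_gt less_imp_neq[THEN not_sym])
  hence ev: "eventually (\<lambda>n. Y (s n t) \<omega> = Y (max 0 t) \<omega>) sequentially" if "\<omega> \<in> space M" for t \<omega>
    using right[OF that, of "max 0 t"] by (auto simp: filterlim_iff)
  show ?thesis
    unfolding measurable_count_space_eq2_countable
  proof safe
    fix a
    have "(\<lambda>(t, \<omega>). Y (max 0 t) \<omega>) -` {a} \<inter> space ?B
        = {p \<in> space ?B. \<exists>N. \<forall>n\<ge>N. Y (s n (fst p)) (snd p) = a}" (is "?L = ?R")
    proof (intro set_eqI)
      fix p
      show "p \<in> ?L \<longleftrightarrow> p \<in> ?R"
      proof (cases "p \<in> space ?B")
        case True
        hence "snd p \<in> space M" by (auto simp: space_pair_measure)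
        from ev[OF this, of "fst p"] obtain N where
          N: "\<forall>n\<ge>N. Y (s n (fst p)) (snd p) = Y (max 0 (fst p)) (snd p)"
          by (auto simp: eventually_sequentially)
        hence "(\<exists>N. \<forall>n\<ge>N. Y (s n (fst p)) (snd p) = a) \<longleftrightarrow> Y (max 0 (fst p)) (snd p) = a"
          by (metis max.cobounded1 max.cobounded2)
        thus ?thesis using True by (auto simp: case_prod_beta)
      qed auto
    qed
    also have "\<dots> \<in> sets ?B" by measurable
    finally show "(\<lambda>(t, \<omega>). Y (max 0 t) \<omega>) -` {a} \<inter> space ?B \<in> sets ?B" .
  qed auto
qed

section \<open>Comparison for the heat equation\<close>

lemma DERIV_nonneg_imp_mono_except_finite:
  fixes h :: "real \<Rightarrow> real"
  assumes "a \<le> b" "finite S" and cont: "continuous_on {a..b} h"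
    and der: "\<And>t. a < t \<Longrightarrow> t < b \<Longrightarrow> t \<notin> S \<Longrightarrow> \<exists>D\<ge>0. (h has_real_derivative D) (at t)"
  shows "h a \<le> h b"
proof -
  obtain D where D: "\<And>t. a < t \<Longrightarrow> t < b \<Longrightarrow> t \<notin> S \<Longrightarrow> D t \<ge> 0 \<and> (h has_real_derivative D t) (at t)"
    using der by metis
  define D' where "D' t = (if a < t \<and> t < b \<and> t \<notin> S then D t else 0)" for t
  have "(D' has_integral (h b - h a)) {a..b}"
    by (rule fundamental_theorem_of_calculus_interior_strong[OF assms(2,1) _ cont])
       (use D in \<open>auto simp: D'_def has_real_derivative_iff_has_vector_derivative[symmetric]\<close>)
  moreover have "D' t \<ge> 0" for t using D by (auto simp: D'_def)
  ultimately have "0 \<le> h b - h a" by (rule has_integral_nonneg)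
  thus ?thesis by simp
qed

text \<open>Isolates the diagonal part, which an exponential factor in time removes; what remains
  has nonnegative coefficients, as \<open>heat_comparison\<close> requires.\<close>

lemma lattice_laplacian_neighbours:
  fixes x :: "int ^ 'd"
  shows "lattice_laplacian f x = sum f (lattice_neighbours x) - 2 * real CARD('d) * f x"
  unfolding lattice_laplacian_eq sum_lattice_neighbours by (simp add: sum.distrib sum_subtractf)

text \<open>Each iteration improves the lower bound \<open>- B (2dct)\<^sup>n / n!\<close>, which tends to \<open>0\<close>.\<close>

lemma heat_comparison:
  fixes \<psi> :: "real \<Rightarrow> int ^ 'd \<Rightarrow> real"
  assumes c: "c \<ge> 0" and B: "B \<ge> 0"
    and cont: "\<And>x. continuous_on {0..T} (\<lambda>t. \<psi> t x)"
    and init: "\<And>x. \<psi> 0 x \<ge> 0"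
    and bound: "\<And>t x. 0 \<le> t \<Longrightarrow> t \<le> T \<Longrightarrow> \<psi> t x \<ge> - B"
    and S: "finite S"
    and der: "\<And>t x. 0 < t \<Longrightarrow> t < T \<Longrightarrow> t \<notin> S \<Longrightarrow>
        \<exists>D \<ge> c * sum (\<psi> t) (lattice_neighbours x). ((\<lambda>t. \<psi> t x) has_real_derivative D) (at t)"
    and t: "0 \<le> t" "t \<le> T"
  shows "\<psi> t x \<ge> 0"
proof -
  let ?m = "2 * real CARD('d)"
  have low: "\<psi> t x \<ge> - (B * ((?m * c * t) ^ n / fact n))" if "0 \<le> t" "t \<le> T" for n t x
    using that
  proof (induction n arbitrary: t x)
    case 0
    thus ?case using bound by simp
  next
    case (Suc n)
    let ?h = "\<lambda>t. \<psi> t x + B * ((?m * c * t) ^ Suc n / fact (Suc n))"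
    have "?h 0 \<le> ?h t"
    proof (rule DERIV_nonneg_imp_mono_except_finite[OF Suc.prems(1) S])
      have "continuous_on {0..t} (\<lambda>t. \<psi> t x)"
        using Suc.prems by (intro continuous_on_subset[OF cont]) auto
      thus "continuous_on {0..t} ?h" by (intro continuous_intros) auto
      fix s assume s: "0 < s" "s < t" "s \<notin> S"
      then obtain D where D: "D \<ge> c * sum (\<psi> s) (lattice_neighbours x)" "((\<lambda>t. \<psi> t x) has_real_derivative D) (at s)"
        using der[of s x] Suc.prems by auto
      let ?E = "B * ((?m * c * s) ^ n / fact n)"
      have "((\<lambda>t. B * ((?m * c * t) ^ Suc n / fact (Suc n))) has_real_derivative
          B * (real (Suc n) * (?m * c * s) ^ n * (?m * c) / fact (Suc n))) (at s)"
        by (auto intro!: derivative_eq_intros simp del: power_Suc fact_Suc of_nat_Suc)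
      also have "B * (real (Suc n) * (?m * c * s) ^ n * (?m * c) / fact (Suc n)) = ?m * c * ?E"
        by (simp add: field_simps del: of_nat_Suc)
      finally have d: "(?h has_real_derivative (D + ?m * c * ?E)) (at s)"
        by (intro DERIV_add D(2))
      have "(\<Sum>i\<in>(UNIV::'d set). (- ?E) + (- ?E)) \<le> sum (\<psi> s) (lattice_neighbours x)"
        unfolding sum_lattice_neighbours
        by (intro sum_mono add_mono Suc.IH) (use s Suc.prems in auto)
      hence "c * (?m * (- ?E)) \<le> c * sum (\<psi> s) (lattice_neighbours x)"
        by (intro mult_left_mono c) (simp add: sum_negf mult_ac)
      hence "D + ?m * c * ?E \<ge> 0" using D(1) by (simp add: algebra_simps)
      thus "\<exists>D\<ge>0. (?h has_real_derivative D) (at s)" using d by blast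
    qed
    thus ?case using init[of x] by simp
  qed
  have "(\<lambda>n. - (B * ((?m * c * t) ^ n / fact n))) \<longlonglongrightarrow> - (B * 0)"
    by (intro tendsto_intros power_over_fact_tendsto_0)
  from LIMSEQ_le_const2[OF this, of "\<psi> t x"] low[OF t] show ?thesis by auto
qed

section \<open>The solution along a fixed path of the trap\<close>

text \<open>The two kernel facts are assumptions because they were derived from a walk and a single
  path carries none; the law of the trap supplies them later.\<close>

locale pam_path =
  fixes \<kappa> \<gamma> :: real and y :: "real \<Rightarrow> int ^ 'd" and z :: "int ^ 'd" and u :: "real \<Rightarrow> int ^ 'd \<Rightarrow> real"
  assumes \<kappa>: "\<kappa> > 0" and \<gamma>: "\<gamma> < 0"
    and path_right: "\<And>t. t \<ge> 0 \<Longrightarrow> eventually (\<lambda>s. y s = y t) (at_right t)"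
    and path_left: "\<And>t. t > 0 \<Longrightarrow> \<exists>v. eventually (\<lambda>s. y s = v) (at_left t)"
    and solution: "pam_solution \<kappa> (\<lambda>t x. \<gamma> * lattice_delta (y t) x) (lattice_delta z) u"
    and heat_kernel_nonneg: "\<And>t x. t \<ge> 0 \<Longrightarrow> heat_kernel t (x :: int ^ 'd) \<ge> 0"
    and has_sum_heat_kernel: "\<And>t. t \<ge> 0 \<Longrightarrow> ((heat_kernel t :: int ^ 'd \<Rightarrow> real) has_sum 1) UNIV"
begin

lemma u_nonneg: "t \<ge> 0 \<Longrightarrow> u t x \<ge> 0"
  using solution by (auto simp: pam_solution_def)

lemma u_initial: "u 0 x = lattice_delta z x"
  using solution by (auto simp: pam_solution_def)

lemma continuous_on_u: "continuous_on {0..} (\<lambda>t. u t x)"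
  using solution by (auto simp: pam_solution_def)

lemma continuous_on_u' [continuous_intros]:
  assumes "continuous_on S f" "\<And>s. s \<in> S \<Longrightarrow> f s \<ge> 0" shows "continuous_on S (\<lambda>s. u (f s) x)"
  by (rule continuous_on_compose2[OF continuous_on_u assms(1)]) (use assms in auto)

definition jumps :: "real set" where
  "jumps = {t. 0 < t \<and> \<not> eventually (\<lambda>s. y s = y t) (at t)}"

lemma finite_jumps_interval: "finite ({0..T} \<inter> jumps)"
  unfolding jumps_def by (rule finite_jumps[OF path_right path_left])

lemma DERIV_u:
  assumes "t > 0" "t \<notin> jumps"
  shows "((\<lambda>s. u s x) has_real_derivative
      \<kappa> * lattice_laplacian (u t) x + \<gamma> * lattice_delta (y t) x * u t x) (at t)"
proof -
  have "eventually (\<lambda>s. y s = y t) (at t)" using assms by (auto simp: jumps_def)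
  hence "eventually (\<lambda>s. \<gamma> * lattice_delta (y s) x = \<gamma> * lattice_delta (y t) x) (at t)"
    by (rule eventually_mono) simp
  hence "isCont (\<lambda>s. \<gamma> * lattice_delta (y s) x) t"
    unfolding isCont_def by (rule tendsto_eventually)
  thus ?thesis using solution assms unfolding pam_solution_def by blast
qed

text \<open>No growth of \<open>u\<close> in space is assumed; nonnegativity alone gives the integrability against the
  heat kernel that makes the boundary terms at infinity in Duhamel's formula vanish.\<close>

lemma sum_heat_kernel_u_le:
  assumes "0 \<le> t" "t \<le> T" "finite F"
  shows "(\<Sum>x\<in>F. heat_kernel (\<kappa> * (T - t)) (x - w) * u t x) \<le> exp (- \<gamma> * (T - t)) * u T w"
proof -
  let ?m = "2 * real CARD('d)"
  \<comment> \<open>The factor exp(2d\<kappa>s) cancels the diagonal of the Laplacian, and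
    exp(-\<gamma>s) turns the potential into \<gamma>(\<delta> - 1), which is nonnegative.
    Restricting to a finite \<open>F\<close> gives \<psi> the lower bound that the comparison
    needs.\<close>
  define \<psi> where "\<psi> s x = exp ((?m * \<kappa> - \<gamma>) * s) * u (t + s) x
      - (\<Sum>x'\<in>F. exp (?m * \<kappa> * s) * heat_kernel (\<kappa> * s) (x' - x) * u t x')" for s x
  let ?B = "\<Sum>x'\<in>F. exp (?m * \<kappa> * (T - t)) * u t x'"
  have ut: "u t x \<ge> 0" for x using u_nonneg assms by auto
  have "\<psi> (T - t) w \<ge> 0"
  proof (rule heat_comparison[where \<psi>=\<psi> and t="T - t" and x=w and c=\<kappa> and B="?B" and T="T - t" and S="(\<lambda>s. s - t) ` ({0..T} \<inter> jumps)"])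
    show "?B \<ge> 0" by (intro sum_nonneg mult_nonneg_nonneg ut) auto
    show "continuous_on {0..T - t} (\<lambda>s. \<psi> s x)" for x
      unfolding \<psi>_def using assms by (intro continuous_intros) auto
    show "\<psi> 0 x \<ge> 0" for x
    proof -
      have "(\<Sum>x'\<in>F. heat_kernel 0 (x' - x) * u t x') = (\<Sum>x'\<in>F. if x' = x then u t x' else 0)"
        by (intro sum.cong) (auto simp: heat_kernel_at_0)
      also have "\<dots> \<le> u t x" using assms ut by simp
      finally show ?thesis by (simp add: \<psi>_def)
    qed
    show "\<psi> s x \<ge> - ?B" if "0 \<le> s" "s \<le> T - t" for s x
    proof -
      have "(\<Sum>x'\<in>F. exp (?m * \<kappa> * s) * heat_kernel (\<kappa> * s) (x' - x) * u t x')
          \<le> (\<Sum>x'\<in>F. exp (?m * \<kappa> * (T - t)) * 1 * u t x')"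
        using that \<kappa> abs_heat_kernel_le_1[of "\<kappa> * s"]
        by (intro sum_mono mult_mono ut mult_nonneg_nonneg heat_kernel_nonneg) (auto simp: abs_le_iff)
      moreover have "exp ((?m * \<kappa> - \<gamma>) * s) * u (t + s) x \<ge> 0"
        using u_nonneg that assms by auto
      ultimately show ?thesis by (simp add: \<psi>_def)
    qed
    show "finite ((\<lambda>s. s - t) ` ({0..T} \<inter> jumps))" by (intro finite_imageI finite_jumps_interval)
    fix s x assume s: "0 < s" "s < T - t" "s \<notin> (\<lambda>s. s - t) ` ({0..T} \<inter> jumps)"
    have nj: "t + s \<notin> jumps"
    proof
      assume "t + s \<in> jumps"
      hence "t + s - t \<in> (\<lambda>s. s - t) ` ({0..T} \<inter> jumps)" using s assms by (intro imageI) auto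
      thus False using s by simp
    qed
    let ?e = "exp ((?m * \<kappa> - \<gamma>) * s)"
    let ?D1 = "?e * (\<kappa> * sum (u (t + s)) (lattice_neighbours x) + \<gamma> * (lattice_delta (y (t + s)) x - 1) * u (t + s) x)"
    let ?D2 = "\<lambda>x'. \<kappa> * (\<Sum>v\<in>lattice_neighbours x. exp (?m * \<kappa> * s) * heat_kernel (\<kappa> * s) (x' - v) * u t x')"
    have "((\<lambda>s. u (t + s) x) has_real_derivative
        (\<kappa> * lattice_laplacian (u (t + s)) x + \<gamma> * lattice_delta (y (t + s)) x * u (t + s) x)) (at s)"
      using DERIV_u[OF _ nj, of x] s assms DERIV_shift[of "\<lambda>s. u s x" _ s t]
      by (simp add: add.commute)
    note du = this
    have "((\<lambda>s. exp ((?m * \<kappa> - \<gamma>) * s)) has_real_derivative ?e * (?m * \<kappa> - \<gamma>)) (at s)"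
      by (auto intro!: derivative_eq_intros)
    from DERIV_mult[OF this du]
    have d1: "((\<lambda>s. exp ((?m * \<kappa> - \<gamma>) * s) * u (t + s) x) has_real_derivative ?D1) (at s)"
      by (rule DERIV_cong) (simp add: lattice_laplacian_neighbours algebra_simps)
    have d2: "((\<lambda>s. exp (?m * \<kappa> * s) * heat_kernel (\<kappa> * s) (x' - x) * u t x') has_real_derivative ?D2 x') (at s)" for x'
    proof -
      have k: "((\<lambda>s. heat_kernel (\<kappa> * s) (x' - x)) has_real_derivative
          lattice_laplacian (heat_kernel (\<kappa> * s)) (x' - x) * \<kappa>) (at s)"
        by (rule DERIV_chain2[OF DERIV_heat_kernel]) (auto intro!: derivative_eq_intros)
      have nb: "sum (heat_kernel (\<kappa> * s)) (lattice_neighbours (x' - x)) = (\<Sum>v\<in>lattice_neighbours x. heat_kernel (\<kappa> * s) (x' - v))"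
        unfolding sum_lattice_neighbours by (intro sum.cong refl) (simp add: algebra_simps diff_diff_eq2 diff_diff_eq)
      have "((\<lambda>s. exp (?m * \<kappa> * s) * heat_kernel (\<kappa> * s) (x' - x) * u t x') has_real_derivative
          (exp (?m * \<kappa> * s) * (?m * \<kappa>) * heat_kernel (\<kappa> * s) (x' - x)
            + lattice_laplacian (heat_kernel (\<kappa> * s)) (x' - x) * \<kappa> * exp (?m * \<kappa> * s)) * u t x') (at s)"
        by (intro DERIV_cmult_right DERIV_mult k) (auto intro!: derivative_eq_intros)
      also have "(exp (?m * \<kappa> * s) * (?m * \<kappa>) * heat_kernel (\<kappa> * s) (x' - x)
            + lattice_laplacian (heat_kernel (\<kappa> * s)) (x' - x) * \<kappa> * exp (?m * \<kappa> * s)) * u t x' = ?D2 x'"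
        unfolding lattice_laplacian_neighbours nb
        by (simp add: sum_distrib_left[symmetric] sum_distrib_right[symmetric] algebra_simps)
      finally show ?thesis .
    qed
    have "((\<lambda>s. \<psi> s x) has_real_derivative (?D1 - (\<Sum>x'\<in>F. ?D2 x'))) (at s)"
      unfolding \<psi>_def by (intro DERIV_diff DERIV_sum d1 d2)
    moreover have "\<kappa> * sum (\<psi> s) (lattice_neighbours x) \<le> ?D1 - (\<Sum>x'\<in>F. ?D2 x')"
    proof -
      have "\<gamma> * (lattice_delta (y (t + s)) x - 1) * u (t + s) x \<ge> 0"
        using \<gamma> u_nonneg[of "t + s" x] s assms by (auto simp: lattice_delta_def mult_nonpos_nonneg)
      hence "?D1 \<ge> ?e * (\<kappa> * sum (u (t + s)) (lattice_neighbours x))"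
        by (intro mult_left_mono) auto
      moreover have "\<kappa> * sum (\<psi> s) (lattice_neighbours x) = ?e * (\<kappa> * sum (u (t + s)) (lattice_neighbours x)) - (\<Sum>x'\<in>F. ?D2 x')"
        unfolding \<psi>_def sum_subtractf
        by (subst sum.swap) (simp add: sum_distrib_left sum_distrib_right right_diff_distrib mult_ac)
      ultimately show ?thesis by linarith
    qed
    ultimately show "\<exists>D\<ge>\<kappa> * sum (\<psi> s) (lattice_neighbours x). ((\<lambda>s. \<psi> s x) has_real_derivative D) (at s)"
      by blast
  qed (use \<kappa> assms in auto)
  hence "exp (?m * \<kappa> * (T - t)) * (\<Sum>x\<in>F. heat_kernel (\<kappa> * (T - t)) (x - w) * u t x)
      \<le> exp ((?m * \<kappa> - \<gamma>) * (T - t)) * u T w"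
    by (simp add: \<psi>_def sum_distrib_left mult.assoc)
  also have "exp ((?m * \<kappa> - \<gamma>) * (T - t)) * u T w = exp (?m * \<kappa> * (T - t)) * (exp (- \<gamma> * (T - t)) * u T w)"
    by (simp add: exp_add[symmetric] mult.assoc[symmetric]) (simp add: algebra_simps)
  finally show ?thesis by simp
qed

section \<open>Duhamel's formula and the total mass\<close>

lemma continuous_heat_kernel_u:
  "continuous_on {0..T} (\<lambda>t. heat_kernel (\<kappa> * (T - t)) x * u t x')"
  by (intro continuous_intros) auto

text \<open>Green's identity on the whole lattice. The terms of the flux are differences of
  nonnegative functions with finite sums, by \<open>sum_heat_kernel_u_le\<close>, and translation
  invariance of unconditional sums cancels them in pairs.\<close>

lemma has_sum_heat_flux:
  fixes w :: "int ^ 'd"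
  assumes T: "0 \<le> T"
  defines "flux \<equiv> \<lambda>x. integral {0..T} (\<lambda>t. heat_kernel (\<kappa> * (T - t)) (x - w) * lattice_laplacian (u t) x
      - u t x * lattice_laplacian (heat_kernel (\<kappa> * (T - t))) (x - w))"
  shows "(flux has_sum 0) UNIV"
proof -
  \<comment> \<open>Pairs the kernel at \<open>x\<close> with the solution at \<open>x + e\<close>.
    The opposite pairing, kernel at \<open>x + e\<close> with solution at \<open>x\<close>, is then
    \<open>b (- e) (x + e)\<close>, a translate of a function of the same family.\<close>
  define b where "b e x = integral {0..T} (\<lambda>t. heat_kernel (\<kappa> * (T - t)) (x - w) * u t (x + e))" for e x
  have b: "((\<lambda>t. heat_kernel (\<kappa> * (T - t)) (x - w) * u t x') has_integral b e x) {0..T}" if "x' = x + e" for e x x'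
    unfolding b_def that by (intro integrable_integral integrable_continuous_real continuous_heat_kernel_u)
  have nonneg: "heat_kernel (\<kappa> * (T - t)) x * u t x' \<ge> 0" if "t \<in> {0..T}" for t and x x' :: "int ^ 'd"
    using that \<kappa> by (intro mult_nonneg_nonneg heat_kernel_nonneg u_nonneg) auto
  have b_nonneg: "b e x \<ge> 0" for e x
    by (rule has_integral_nonneg[OF b[OF refl]]) (rule nonneg)
  have b_le: "sum (b e) F \<le> exp (- \<gamma> * T) * u T (w + e) * T" if "finite F" for e F
  proof -
    have "((\<lambda>t. \<Sum>x\<in>F. heat_kernel (\<kappa> * (T - t)) (x - w) * u t (x + e)) has_integral sum (b e) F) {0..T}"
      by (intro has_integral_sum that b refl)
    moreover have "((\<lambda>t. exp (- \<gamma> * T) * u T (w + e)) has_integral exp (- \<gamma> * T) * u T (w + e) * T) {0..T}"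
      using has_integral_const_real[of "exp (- \<gamma> * T) * u T (w + e)" 0 T] T by (simp add: mult.commute)
    ultimately show ?thesis
    proof (rule has_integral_le)
      fix t assume t: "t \<in> {0..T}"
      have "(\<Sum>x\<in>F. heat_kernel (\<kappa> * (T - t)) (x - w) * u t (x + e))
          = (\<Sum>x\<in>(\<lambda>x. x + e) ` F. heat_kernel (\<kappa> * (T - t)) (x - (w + e)) * u t x)"
        by (subst sum.reindex) (auto simp: inj_on_def algebra_simps)
      also have "\<dots> \<le> exp (- \<gamma> * (T - t)) * u T (w + e)"
        by (rule sum_heat_kernel_u_le) (use t that in auto)
      also have "\<dots> \<le> exp (- \<gamma> * T) * u T (w + e)"
        using t \<gamma> T by (intro mult_right_mono u_nonneg) (auto intro!: mult_left_mono_neg)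
      finally show "(\<Sum>x\<in>F. heat_kernel (\<kappa> * (T - t)) (x - w) * u t (x + e)) \<le> exp (- \<gamma> * T) * u T (w + e)" .
    qed
  qed
  define S where "S e = infsum (b e) UNIV" for e
  have S: "(b e has_sum S e) UNIV" for e
    unfolding S_def
    by (intro has_sum_infsum nonneg_bdd_above_summable_on b_nonneg
        bdd_aboveI2[where M="exp (- \<gamma> * T) * u T (w + e) * T"] b_le) auto
  have S_shift: "((\<lambda>x. b e (x + v)) has_sum S e) UNIV" for e v
    using S[of e] has_sum_reindex_bij_betw[of "\<lambda>x. x + v" UNIV UNIV "b e" "S e"]
    by (simp add: bij_plus_right)
  have flux_eq: "flux x = (\<Sum>i\<in>UNIV. (b (axis i 1) x + b (- axis i 1) x)
      - (b (- axis i 1) (x + axis i 1) + b (axis i 1) (x + - axis i 1)))" for x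
    unfolding flux_def
  proof (intro integral_unique)
    have "((\<lambda>t. \<Sum>i\<in>UNIV. (heat_kernel (\<kappa> * (T - t)) (x - w) * u t (x + axis i 1) + heat_kernel (\<kappa> * (T - t)) (x - w) * u t (x - axis i 1))
      - (heat_kernel (\<kappa> * (T - t)) ((x + axis i 1) - w) * u t x + heat_kernel (\<kappa> * (T - t)) ((x + - axis i 1) - w) * u t x))
      has_integral (\<Sum>i\<in>UNIV. (b (axis i 1) x + b (- axis i 1) x)
      - (b (- axis i 1) (x + axis i 1) + b (axis i 1) (x + - axis i 1)))) {0..T}"
      by (intro has_integral_sum has_integral_diff has_integral_add b) auto
    also have "(\<lambda>t. \<Sum>i\<in>UNIV. (heat_kernel (\<kappa> * (T - t)) (x - w) * u t (x + axis i 1) + heat_kernel (\<kappa> * (T - t)) (x - w) * u t (x - axis i 1))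
      - (heat_kernel (\<kappa> * (T - t)) ((x + axis i 1) - w) * u t x + heat_kernel (\<kappa> * (T - t)) ((x + - axis i 1) - w) * u t x))
      = (\<lambda>t. heat_kernel (\<kappa> * (T - t)) (x - w) * lattice_laplacian (u t) x
      - u t x * lattice_laplacian (heat_kernel (\<kappa> * (T - t))) (x - w))"
      unfolding lattice_laplacian_eq sum_distrib_left sum_subtractf[symmetric]
      by (intro ext sum.cong refl) (simp add: algebra_simps)
    finally show "((\<lambda>t. heat_kernel (\<kappa> * (T - t)) (x - w) * lattice_laplacian (u t) x
      - u t x * lattice_laplacian (heat_kernel (\<kappa> * (T - t))) (x - w)) has_integral
      (\<Sum>i\<in>UNIV. (b (axis i 1) x + b (- axis i 1) x)
      - (b (- axis i 1) (x + axis i 1) + b (axis i 1) (x + - axis i 1)))) {0..T}" .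
  qed
  have sum_rule: "((\<lambda>x. \<Sum>i\<in>A. g i x) has_sum 0) UNIV"
    if "finite A" "\<And>i. (g i has_sum 0) UNIV" for A :: "'d set" and g :: "'d \<Rightarrow> int ^ 'd \<Rightarrow> real"
    using that(1)
  proof (induction A)
    case (insert i A)
    thus ?case using has_sum_add[OF that(2)[of i] insert.IH] by simp
  qed simp
  have "((\<lambda>x. (b (axis i 1) x + b (- axis i 1) x)
      - (b (- axis i 1) (x + axis i 1) + b (axis i 1) (x + - axis i 1))) has_sum 0) UNIV" for i
    using has_sum_add[OF has_sum_add[OF S[of "axis i 1"] S[of "- axis i 1"]]
       has_sum_uminusI[OF has_sum_add[OF S_shift[of "- axis i 1" "axis i 1"] S_shift[of "axis i 1" "- axis i 1"]]]]
    by (simp add: algebra_simps)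
  from sum_rule[OF finite this] show ?thesis
    unfolding flux_eq[abs_def] .
qed

text \<open>Duhamel's formula at one site, before summation: the fundamental theorem of calculus for
  the product of the time-reversed kernel and \<open>u\<close>, with the jump times as exceptional
  set, solved for the source term.\<close>

lemma has_integral_source:
  fixes w x :: "int ^ 'd"
  assumes T: "0 \<le> T"
  shows "((\<lambda>t. heat_kernel (\<kappa> * (T - t)) (x - w) * lattice_delta (y t) x * u t x) has_integral
    (heat_kernel 0 (x - w) * u T x - heat_kernel (\<kappa> * T) (x - w) * u 0 x
      - \<kappa> * integral {0..T} (\<lambda>t. heat_kernel (\<kappa> * (T - t)) (x - w) * lattice_laplacian (u t) x
      - u t x * lattice_laplacian (heat_kernel (\<kappa> * (T - t))) (x - w))) / \<gamma>) {0..T}"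
    (is "(?S has_integral _) _")
proof -
  let ?h = "\<lambda>t. heat_kernel (\<kappa> * (T - t)) (x - w) * u t x"
  let ?F = "\<lambda>t. heat_kernel (\<kappa> * (T - t)) (x - w) * lattice_laplacian (u t) x
      - u t x * lattice_laplacian (heat_kernel (\<kappa> * (T - t))) (x - w)"
  have "((\<lambda>t. \<kappa> * ?F t + \<gamma> * ?S t) has_integral (?h T - ?h 0)) {0..T}"
  proof (rule fundamental_theorem_of_calculus_interior_strong[OF finite_jumps_interval[of T] T])
    show "continuous_on {0..T} ?h" by (rule continuous_heat_kernel_u)
    fix t assume t: "t \<in> {0<..<T} - {0..T} \<inter> jumps"
    have k: "((\<lambda>t. heat_kernel (\<kappa> * (T - t)) (x - w)) has_real_derivative
          lattice_laplacian (heat_kernel (\<kappa> * (T - t))) (x - w) * (- \<kappa>)) (at t)"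
      by (rule DERIV_chain2[OF DERIV_heat_kernel]) (auto intro!: derivative_eq_intros)
    have du: "((\<lambda>s. u s x) has_real_derivative
      \<kappa> * lattice_laplacian (u t) x + \<gamma> * lattice_delta (y t) x * u t x) (at t)"
      by (rule DERIV_u) (use t in auto)
    have "(?h has_real_derivative (\<kappa> * ?F t + \<gamma> * ?S t)) (at t)"
      by (rule DERIV_cong[OF DERIV_mult[OF k du]]) (simp add: algebra_simps)
    thus "(?h has_vector_derivative (\<kappa> * ?F t + \<gamma> * ?S t)) (at t)"
      by (simp add: has_real_derivative_iff_has_vector_derivative)
  qed
  moreover have "continuous_on {0..T} ?F"
    unfolding lattice_laplacian_eq by (intro continuous_intros) auto
  hence "((\<lambda>t. \<kappa> * ?F t) has_integral \<kappa> * integral {0..T} ?F) {0..T}"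
    by (intro has_integral_mult_right integrable_integral integrable_continuous_real)
  ultimately have "((\<lambda>t. \<kappa> * ?F t + \<gamma> * ?S t - \<kappa> * ?F t) has_integral (?h T - ?h 0 - \<kappa> * integral {0..T} ?F)) {0..T}"
    by (rule has_integral_diff)
  hence "((\<lambda>t. (\<gamma> * ?S t) / \<gamma>) has_integral (?h T - ?h 0 - \<kappa> * integral {0..T} ?F) / \<gamma>) {0..T}"
    by (intro has_integral_divide) (simp add: algebra_simps)
  thus ?thesis using \<gamma> by simp
qed

lemma measurable_path [measurable]: "(\<lambda>t. y (max 0 t)) \<in> measurable borel (count_space UNIV)"
proof -
  \<comment> \<open>The path is treated as a process on a one-point space.\<close>
  have "(\<lambda>(t, \<omega>). y (max 0 t)) \<in> measurable (borel \<Otimes>\<^sub>M count_space (UNIV :: unit set)) (count_space UNIV)"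
    by (rule measurable_right_constant_process[where Y="\<lambda>t _. y t"]) (use path_right in auto)
  from measurable_Pair2'[of "()" "count_space UNIV" borel, THEN measurable_compose, OF _ this]
  show ?thesis by simp
qed

lemma measurable_u [measurable]: "(\<lambda>t. u (max 0 t) x) \<in> borel_measurable borel"
  by (intro borel_measurable_continuous_onI continuous_intros) auto

lemma measurable_u_path [measurable]: "(\<lambda>t. u (max 0 t) (y (max 0 t))) \<in> borel_measurable borel"
  by (rule measurable_compose_countable[of "\<lambda>x t. u (max 0 t) x"]) auto

text \<open>Sum \<open>has_integral_source\<close> over \<open>x\<close>: the flux contributes 0,
  and the boundary terms collapse to the sites \<open>w\<close> at time \<open>T\<close> and
  \<open>z\<close> at time 0. All source terms are nonnegative, which permits Tonelli and, as
  \<gamma> < 0, also gives the upper bound for \<open>u\<close>.\<close>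

lemma nn_integral_duhamel:
  assumes T: "0 \<le> T"
  shows "(\<integral>\<^sup>+t. ennreal (indicator {0..T} t * (heat_kernel (\<kappa> * (T - t)) (y (max 0 t) - w) * u (max 0 t) (y (max 0 t)))) \<partial>lborel)
    = ennreal ((heat_kernel (\<kappa> * T) (z - w) - u T w) / - \<gamma>)"
    and "u T w \<le> heat_kernel (\<kappa> * T) (z - w)"
proof -
  define I where "I x = (heat_kernel 0 (x - w) * u T x - heat_kernel (\<kappa> * T) (x - w) * u 0 x
      - \<kappa> * integral {0..T} (\<lambda>t. heat_kernel (\<kappa> * (T - t)) (x - w) * lattice_laplacian (u t) x
      - u t x * lattice_laplacian (heat_kernel (\<kappa> * (T - t))) (x - w))) / \<gamma>" for x
  let ?S = "\<lambda>x t. heat_kernel (\<kappa> * (T - t)) (x - w) * lattice_delta (y t) x * u t x"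
  have S: "(?S x has_integral I x) {0..T}" for x
    unfolding I_def by (rule has_integral_source[OF T])
  have S_nonneg: "?S x t \<ge> 0" if "t \<in> {0..T}" for x t
    using that \<kappa> by (intro mult_nonneg_nonneg heat_kernel_nonneg u_nonneg) (auto simp: lattice_delta_def)
  have I_nonneg: "I x \<ge> 0" for x
    by (rule has_integral_nonneg[OF S S_nonneg])
  have h1: "((\<lambda>x. heat_kernel 0 (x - w) * u T x) has_sum u T w) UNIV"
    by (rule has_sum_finite_neutralI[of "{w}"]) (auto simp: heat_kernel_at_0)
  have h2: "((\<lambda>x. heat_kernel (\<kappa> * T) (x - w) * u 0 x) has_sum heat_kernel (\<kappa> * T) (z - w)) UNIV"
    by (rule has_sum_finite_neutralI[of "{z}"]) (auto simp: u_initial lattice_delta_def)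
  note h3 = has_sum_cmult_right[OF has_sum_heat_flux[OF T, of w], of \<kappa>]
  from has_sum_cmult_right[OF has_sum_add[OF has_sum_add[OF h1 has_sum_uminusI[OF h2]] has_sum_uminusI[OF h3]], of "inverse \<gamma>"]
  have "(I has_sum inverse \<gamma> * (u T w + - heat_kernel (\<kappa> * T) (z - w) + - (\<kappa> * 0))) UNIV"
    unfolding I_def[abs_def] by (simp add: divide_inverse mult.commute)
  also have "inverse \<gamma> * (u T w + - heat_kernel (\<kappa> * T) (z - w) + - (\<kappa> * 0)) = (heat_kernel (\<kappa> * T) (z - w) - u T w) / - \<gamma>"
    by (simp add: divide_inverse algebra_simps)
  finally have I_sum: "(I has_sum (heat_kernel (\<kappa> * T) (z - w) - u T w) / - \<gamma>) UNIV" (is "(I has_sum ?R) _") .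
  hence R: "?R \<ge> 0" by (rule has_sum_nonneg) (rule I_nonneg)
  thus "u T w \<le> heat_kernel (\<kappa> * T) (z - w)"
    using \<gamma> by (simp add: zero_le_divide_iff divide_le_0_iff)
  have "ennreal ?R = (\<integral>\<^sup>+x. ennreal (I x) \<partial>count_space UNIV)"
    using I_sum has_sum_iff_nn_integral[of I ?R] I_nonneg R by simp
  also have "\<dots> = (\<integral>\<^sup>+x. \<integral>\<^sup>+t. ennreal (?S x t) * indicator {0..T} t \<partial>lborel \<partial>count_space UNIV)"
    by (intro nn_integral_cong nn_integral_has_integral_lebesgue'[symmetric] S S_nonneg)
  also have "\<dots> = (\<integral>\<^sup>+x. \<integral>\<^sup>+t. ennreal (indicator {0..T} t * ?S x (max 0 t)) \<partial>lborel \<partial>count_space UNIV)"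
    by (intro nn_integral_cong) (auto simp: indicator_def max_def)
  also have "\<dots> = (\<integral>\<^sup>+t. \<integral>\<^sup>+x. ennreal (indicator {0..T} t * ?S x (max 0 t)) \<partial>count_space UNIV \<partial>lborel)"
  proof (rule nn_integral_count_space_nn_integral[symmetric])
    fix x
    have [measurable]: "(\<lambda>t. lattice_delta (y (max 0 t)) x) \<in> borel_measurable borel"
      by (rule measurable_compose[OF measurable_path]) simp
    have [measurable]: "(\<lambda>t. heat_kernel (\<kappa> * (T - max 0 t)) (x - w)) \<in> borel_measurable borel"
      by (intro borel_measurable_continuous_onI continuous_intros)
    show "(\<lambda>t. ennreal (indicator {0..T} t * ?S x (max 0 t))) \<in> borel_measurable lborel"
      by measurable
  qed auto
  also have "\<dots> = (\<integral>\<^sup>+t. ennreal (indicator {0..T} t * (heat_kernel (\<kappa> * (T - t)) (y (max 0 t) - w) * u (max 0 t) (y (max 0 t)))) \<partial>lborel)"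
  proof (intro nn_integral_cong)
    fix t :: real
    have "(\<integral>\<^sup>+x. ennreal (indicator {0..T} t * ?S x (max 0 t)) \<partial>count_space UNIV)
       = (\<integral>\<^sup>+x. ennreal (indicator {0..T} t * (heat_kernel (\<kappa> * (T - t)) (y (max 0 t) - w) * u (max 0 t) (y (max 0 t)))) * indicator {y (max 0 t)} x \<partial>count_space UNIV)"
      by (intro nn_integral_cong) (auto simp: indicator_def lattice_delta_def max_def)
    thus "(\<integral>\<^sup>+x. ennreal (indicator {0..T} t * ?S x (max 0 t)) \<partial>count_space UNIV)
       = ennreal (indicator {0..T} t * (heat_kernel (\<kappa> * (T - t)) (y (max 0 t) - w) * u (max 0 t) (y (max 0 t))))"
      by (simp add: nn_integral_cmult_indicator)
  qed
  finally show "(\<integral>\<^sup>+t. ennreal (indicator {0..T} t * (heat_kernel (\<kappa> * (T - t)) (y (max 0 t) - w) * u (max 0 t) (y (max 0 t)))) \<partial>lborel) = ennreal ?R" ..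
qed

lemma u_le_1: "0 \<le> t \<Longrightarrow> u t x \<le> 1"
  using nn_integral_duhamel(2)[of t x] abs_heat_kernel_le_1[of "\<kappa> * t" "z - x"] \<kappa> by auto

lemma measurable_heat_kernel_path [measurable]:
  "(\<lambda>t. heat_kernel (\<kappa> * (T - t)) (y (max 0 t) - w)) \<in> borel_measurable borel"
  by (rule measurable_compose_countable[of "\<lambda>x t. heat_kernel (\<kappa> * (T - t)) (x - w)"]) auto

theorem duhamel:
  assumes T: "0 \<le> T"
  shows "u T w = heat_kernel (\<kappa> * T) (z - w) + \<gamma> * (\<integral>t. indicator {0..T} t *
      (heat_kernel (\<kappa> * (T - t)) (y (max 0 t) - w) * u (max 0 t) (y (max 0 t))) \<partial>lborel)"
proof -
  let ?f = "\<lambda>t. indicator {0..T} t * (heat_kernel (\<kappa> * (T - t)) (y (max 0 t) - w) * u (max 0 t) (y (max 0 t)))"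
  have nonneg: "0 \<le> ?f t" for t
    using \<kappa> by (auto simp: indicator_def intro!: mult_nonneg_nonneg heat_kernel_nonneg u_nonneg)
  have "integral\<^sup>L lborel ?f = enn2real (\<integral>\<^sup>+t. ennreal (?f t) \<partial>lborel)"
    by (rule integral_eq_nn_integral) (use nonneg in auto)
  also have "\<dots> = (heat_kernel (\<kappa> * T) (z - w) - u T w) / - \<gamma>"
    unfolding nn_integral_duhamel(1)[OF T] using nn_integral_duhamel(2)[OF T, of w] \<gamma>
    by (intro enn2real_ennreal divide_nonneg_pos) auto
  finally show ?thesis using \<gamma> by (simp add: field_simps)
qed

theorem has_sum_u:
  assumes T: "0 \<le> T"
  shows "(u T has_sum (1 + \<gamma> * (\<integral>t. indicator {0..T} t * u (max 0 t) (y (max 0 t)) \<partial>lborel))) UNIV"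
proof -
  let ?R = "\<lambda>w. (heat_kernel (\<kappa> * T) (z - w) - u T w) / - \<gamma>"
  let ?a = "\<lambda>t. u (max 0 t) (y (max 0 t))"
  have a: "0 \<le> ?a t" "?a t \<le> 1" for t by (auto intro: u_nonneg u_le_1)
  have int: "integrable lborel (\<lambda>t. indicator {0..T} t * ?a t)"
  proof (rule integrable_indicator_Icc_bounded[where B=1])
    show "?a \<in> borel_measurable borel" by (rule measurable_u_path)
    show "\<bar>?a t\<bar> \<le> 1" for t using a[of t] by linarith
  qed
  have bij: "bij (\<lambda>w. x - w)" for x :: "int ^ 'd"
    by (rule o_bij[of "\<lambda>w. x - w"]) auto
  \<comment> \<open>Reflection at \<open>x\<close> carries mass one over to the kernel as a function
    of its endpoint.\<close>
  have K: "((\<lambda>w. heat_kernel t (x - w)) has_sum 1) UNIV" if "t \<ge> 0" for t and x :: "int ^ 'd"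
    using has_sum_heat_kernel[OF that] has_sum_reindex_bij_betw[of "\<lambda>w. x - w" UNIV UNIV "heat_kernel t" 1]
    by (simp add: bij)
  have R: "?R w \<ge> 0" for w
    using nn_integral_duhamel(2)[OF T, of w] \<gamma> by (intro divide_nonneg_pos) auto
  have "(\<integral>\<^sup>+w. ennreal (?R w) \<partial>count_space UNIV) = (\<integral>\<^sup>+w. \<integral>\<^sup>+t. ennreal (indicator {0..T} t * (heat_kernel (\<kappa> * (T - t)) (y (max 0 t) - w) * ?a t)) \<partial>lborel \<partial>count_space UNIV)"
    unfolding nn_integral_duhamel(1)[OF T] ..
  also have "\<dots> = (\<integral>\<^sup>+t. \<integral>\<^sup>+w. ennreal (indicator {0..T} t * (heat_kernel (\<kappa> * (T - t)) (y (max 0 t) - w) * ?a t)) \<partial>count_space UNIV \<partial>lborel)"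
    by (rule nn_integral_count_space_nn_integral[symmetric]) auto
  also have "\<dots> = (\<integral>\<^sup>+t. ennreal (indicator {0..T} t * ?a t) \<partial>lborel)"
  proof (intro nn_integral_cong)
    fix t :: real
    show "(\<integral>\<^sup>+w. ennreal (indicator {0..T} t * (heat_kernel (\<kappa> * (T - t)) (y (max 0 t) - w) * ?a t)) \<partial>count_space UNIV)
        = ennreal (indicator {0..T} t * ?a t)"
    proof (cases "t \<in> {0..T}")
      case True
      have "((\<lambda>w. heat_kernel (\<kappa> * (T - t)) (y (max 0 t) - w) * ?a t) has_sum 1 * ?a t) UNIV"
        using True \<kappa> by (intro has_sum_cmult_left K) auto
      hence "(\<integral>\<^sup>+w. ennreal (heat_kernel (\<kappa> * (T - t)) (y (max 0 t) - w) * ?a t) \<partial>count_space UNIV) = ennreal (1 * ?a t)"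
        by (subst (asm) has_sum_iff_nn_integral) (use True \<kappa> a in \<open>auto intro!: mult_nonneg_nonneg heat_kernel_nonneg u_nonneg\<close>)
      thus ?thesis using True by simp
    qed simp
  qed
  also have "\<dots> = ennreal (\<integral>t. indicator {0..T} t * ?a t \<partial>lborel)"
    by (rule nn_integral_eq_integral[OF int]) (use a in auto)
  finally have "(?R has_sum (\<integral>t. indicator {0..T} t * ?a t \<partial>lborel)) UNIV"
    by (subst has_sum_iff_nn_integral) (use R a in \<open>auto intro!: integral_nonneg\<close>)
  \<comment> \<open>Each summand is \<open>u T w\<close> again, by the definition of
    \<open>?R\<close>.\<close>
  hence "((\<lambda>w. heat_kernel (\<kappa> * T) (z - w) + \<gamma> * ?R w) has_sum (1 + \<gamma> * (\<integral>t. indicator {0..T} t * ?a t \<partial>lborel))) UNIV"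
    using T \<kappa> by (intro has_sum_add has_sum_cmult_right K) auto
  thus ?thesis using \<gamma> by simp
qed

end

section \<open>Averaging over the trap\<close>

lemma measurable_diff_count_space [measurable (raw)]:
  fixes f g :: "'a \<Rightarrow> 'b :: {countable, minus}"
  assumes "f \<in> measurable M (count_space UNIV)" "g \<in> measurable M (count_space UNIV)"
  shows "(\<lambda>x. f x - g x) \<in> measurable M (count_space UNIV)"
proof -
  have "(\<lambda>x. (f x, g x)) \<in> measurable M (count_space UNIV \<Otimes>\<^sub>M count_space UNIV)"
    by (intro measurable_Pair assms)
  hence "(\<lambda>x. (f x, g x)) \<in> measurable M (count_space UNIV)"
    by (subst (asm) pair_measure_countable) auto
  from measurable_compose[OF this, of "\<lambda>(x, y). x - y" "count_space UNIV"] show ?thesis by simp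
qed

lemma borel_measurable_heat_kernel2 [measurable (raw)]:
  fixes g :: "'a \<Rightarrow> int ^ 'd"
  assumes f: "f \<in> borel_measurable M" and g: "g \<in> measurable M (count_space UNIV)"
  shows "(\<lambda>x. heat_kernel (f x) (g x)) \<in> borel_measurable M"
  by (rule measurable_compose_countable[OF _ g]) (rule measurable_compose[OF f borel_measurable_heat_kernel])

text \<open>A separate solution is given for each path; how it depends on \<open>\<omega>\<close> is
  established below.\<close>

locale pam = lattice_random_walk M \<rho> "0 :: int ^ 'd" Y
  for M :: "'w measure" and \<rho> :: real and Y :: "real \<Rightarrow> 'w \<Rightarrow> int ^ 'd" +
  fixes \<kappa> \<gamma> :: real and z :: "int ^ 'd" and u :: "'w \<Rightarrow> real \<Rightarrow> int ^ 'd \<Rightarrow> real"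
  assumes \<rho>: "\<rho> > 0" and \<kappa>: "\<kappa> > 0" and \<gamma>: "\<gamma> < 0"
    and solution: "\<omega> \<in> space M \<Longrightarrow>
      pam_solution \<kappa> (\<lambda>t x. \<gamma> * lattice_delta (Y t \<omega>) x) (lattice_delta z) (u \<omega>)"
begin

lemma pam_path: "\<omega> \<in> space M \<Longrightarrow> pam_path \<kappa> \<gamma> (\<lambda>t. Y t \<omega>) z (u \<omega>)"
  using walk \<kappa> \<gamma> solution heat_kernel_nonneg[OF \<rho>] has_sum_heat_kernel[OF \<rho>]
  by (intro pam_path.intro) (auto simp: lattice_walk_def)

text \<open>Freezing the trap at negative times makes it jointly measurable on the whole real
  line.\<close>

definition X :: "real \<Rightarrow> 'w \<Rightarrow> int ^ 'd" where "X t = Y (max 0 t)"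

lemma X_nonneg: "t \<ge> 0 \<Longrightarrow> X t = Y t"
  by (simp add: X_def max_def)

lemma measurable_X [measurable (raw)]:
  assumes f: "f \<in> borel_measurable N" and g: "g \<in> measurable N M"
  shows "(\<lambda>x. X (f x) (g x)) \<in> measurable N (count_space UNIV)"
proof -
  have "(\<lambda>(t, \<omega>). Y (max 0 t) \<omega>) \<in> measurable (borel \<Otimes>\<^sub>M M) (count_space UNIV)"
    using walk by (intro measurable_right_constant_process) (auto simp: lattice_walk_def)
  from measurable_compose[OF measurable_Pair[OF f g] this] show ?thesis by (simp add: X_def)
qed

definition trap_mass :: "real \<Rightarrow> 'w \<Rightarrow> real" where
  "trap_mass t \<omega> = u \<omega> (max 0 t) (X t \<omega>)"

lemma trap_mass_bounds:
  assumes "\<omega> \<in> space M" shows "0 \<le> trap_mass t \<omega>" "trap_mass t \<omega> \<le> 1"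
proof -
  interpret pam_path \<kappa> \<gamma> "\<lambda>t. Y t \<omega>" z "u \<omega>" by (rule pam_path[OF assms])
  show "0 \<le> trap_mass t \<omega>" "trap_mass t \<omega> \<le> 1"
    by (auto simp: trap_mass_def intro: u_nonneg u_le_1)
qed

text \<open>The right side of Duhamel's formula with its endpoint at the trap, and \<open>f\<close>
  in place of the trap mass.\<close>

definition volterra :: "(real \<Rightarrow> 'w \<Rightarrow> real) \<Rightarrow> real \<Rightarrow> 'w \<Rightarrow> real" where
  "volterra f t \<omega> = heat_kernel (\<kappa> * t) (z - X t \<omega>)
     + \<gamma> * (\<integral>s. indicator {0..t} s * (heat_kernel (\<kappa> * (t - s)) (X s \<omega> - X t \<omega>) * f s \<omega>) \<partial>lborel)"

lemma trap_mass_volterra: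
  assumes "\<omega> \<in> space M" "t \<ge> 0"
  shows "trap_mass t \<omega> = volterra trap_mass t \<omega>"
proof -
  interpret pam_path \<kappa> \<gamma> "\<lambda>t. Y t \<omega>" z "u \<omega>" by (rule pam_path[OF assms(1)])
  show ?thesis
    using duhamel[OF assms(2), of "Y t \<omega>"] assms(2) by (simp add: volterra_def trap_mass_def X_def)
qed

text \<open>The trap mass is only known as a fixed point of \<open>volterra\<close>; the convergent iteration
  yields its measurability and lets independence be used for explicit iterates only.\<close>

primrec picard :: "nat \<Rightarrow> real \<Rightarrow> 'w \<Rightarrow> real" where
  "picard 0 = (\<lambda>t \<omega>. 0)"
| "picard (Suc n) = volterra (picard n)"

lemma measurable_volterra:
  assumes [measurable]: "(\<lambda>(t, \<omega>). f t \<omega>) \<in> borel_measurable (borel \<Otimes>\<^sub>M M)"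
  shows "(\<lambda>(t, \<omega>). volterra f t \<omega>) \<in> borel_measurable (borel \<Otimes>\<^sub>M M)"
proof -
  let ?N = "borel \<Otimes>\<^sub>M M :: (real \<times> 'w) measure"
  have [measurable]: "(\<lambda>q. f (snd q) (snd (fst q))) \<in> borel_measurable (?N \<Otimes>\<^sub>M lborel)"
    by (rule measurable_compose[OF _ assms, of "\<lambda>q. (snd q, snd (fst q))", simplified]) measurable
  \<comment> \<open>An indicator of an interval with variable endpoint, written as a condition that
    is visibly measurable jointly in all variables.\<close>
  have "(\<lambda>q. if 0 \<le> snd q \<and> snd q \<le> fst (fst q) then
      heat_kernel (\<kappa> * (fst (fst q) - snd q)) (X (snd q) (snd (fst q)) - X (fst (fst q)) (snd (fst q))) * f (snd q) (snd (fst q)) else 0)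
      \<in> borel_measurable (?N \<Otimes>\<^sub>M lborel)"
    by measurable
  also have "(\<lambda>q. if 0 \<le> snd q \<and> snd q \<le> fst (fst q) then
      heat_kernel (\<kappa> * (fst (fst q) - snd q)) (X (snd q) (snd (fst q)) - X (fst (fst q)) (snd (fst q))) * f (snd q) (snd (fst q)) else 0)
      = (\<lambda>(p, s). indicator {0..fst p} s * (heat_kernel (\<kappa> * (fst p - s)) (X s (snd p) - X (fst p) (snd p)) * f s (snd p)))"
    by (auto simp: fun_eq_iff indicator_def)
  finally have [measurable]: "(\<lambda>p. \<integral>s. indicator {0..fst p} s * (heat_kernel (\<kappa> * (fst p - s)) (X s (snd p) - X (fst p) (snd p)) * f s (snd p)) \<partial>lborel)
      \<in> borel_measurable ?N"
    by (rule lborel.borel_measurable_lebesgue_integral)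
  show ?thesis
    unfolding volterra_def case_prod_beta by measurable
qed

lemma measurable_picard: "(\<lambda>(t, \<omega>). picard n t \<omega>) \<in> borel_measurable (borel \<Otimes>\<^sub>M M)"
  by (induction n) (auto intro: measurable_volterra)

lemma measurable_picard' [measurable (raw)]:
  assumes f: "f \<in> borel_measurable N" and g: "g \<in> measurable N M"
  shows "(\<lambda>x. picard n (f x) (g x)) \<in> borel_measurable N"
  using measurable_compose[OF measurable_Pair[OF f g] measurable_picard[of n]] by simp

lemma measurable_trap_mass_path:
  assumes "\<omega> \<in> space M" shows "(\<lambda>t. trap_mass t \<omega>) \<in> borel_measurable borel"
proof -
  interpret pam_path \<kappa> \<gamma> "\<lambda>t. Y t \<omega>" z "u \<omega>" by (rule pam_path[OF assms])
  show ?thesis using measurable_u_path by (simp add: trap_mass_def X_def)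
qed

text \<open>The kernel is at most 1 in absolute value, so each iteration integrates the previous
  error and multiplies it by at most |\<gamma>|; the initial error is the trap mass itself, at most
  1.\<close>

lemma picard_error:
  assumes \<omega>: "\<omega> \<in> space M" and "0 \<le> t"
  shows "\<bar>picard n t \<omega> - trap_mass t \<omega>\<bar> \<le> (\<bar>\<gamma>\<bar> * t) ^ n / fact n"
  using assms(2)
proof (induction n arbitrary: t)
  case 0
  thus ?case using trap_mass_bounds[OF \<omega>, of t] by simp
next
  case (Suc n)
  let ?K = "\<lambda>s. heat_kernel (\<kappa> * (t - s)) (X s \<omega> - X t \<omega>)"
  have [measurable]: "(\<lambda>t. trap_mass t \<omega>) \<in> borel_measurable borel"
    by (rule measurable_trap_mass_path[OF \<omega>])
  have [measurable]: "(\<lambda>s. \<omega>) \<in> measurable borel M" using \<omega> by simp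
  have K: "\<bar>?K s\<bar> \<le> 1" if "s \<le> t" for s
    using that \<kappa> by (intro abs_heat_kernel_le_1) auto
  have int: "integrable lborel (\<lambda>s. indicator {0..t} s * (?K s * trap_mass s \<omega>))"
  proof (rule integrable_indicator_Icc_bounded[where B="1 * 1"])
    show "\<bar>?K s * trap_mass s \<omega>\<bar> \<le> 1 * 1" if "0 \<le> s" "s \<le> t" for s
      unfolding abs_mult using trap_mass_bounds[OF \<omega>, of s] K that by (intro mult_mono) auto
  qed measurable
  have diff: "\<bar>?K s * (picard n s \<omega> - trap_mass s \<omega>)\<bar> \<le> (\<bar>\<gamma>\<bar> * s) ^ n / fact n" if "0 \<le> s" "s \<le> t" for s
    unfolding abs_mult
    using mult_mono[OF K[OF that(2)] Suc.IH[OF that(1)]] by simp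
  have int2: "integrable lborel (\<lambda>s. indicator {0..t} s * (?K s * (picard n s \<omega> - trap_mass s \<omega>)))"
  proof (rule integrable_indicator_Icc_bounded[where B="(\<bar>\<gamma>\<bar> * t) ^ n / fact n"])
    show "\<bar>?K s * (picard n s \<omega> - trap_mass s \<omega>)\<bar> \<le> (\<bar>\<gamma>\<bar> * t) ^ n / fact n" if "0 \<le> s" "s \<le> t" for s
      by (rule order.trans[OF diff[OF that]]) (use that in \<open>auto intro!: divide_right_mono power_mono mult_left_mono\<close>)
  qed measurable
  \<comment> \<open>Writing the iterate as trap mass plus error reduces its integrability to the two
    bounds just shown.\<close>
  have split: "indicator {0..t} s * (?K s * picard n s \<omega>) = indicator {0..t} s * (?K s * trap_mass s \<omega>)
      + indicator {0..t} s * (?K s * (picard n s \<omega> - trap_mass s \<omega>))" for s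
    by (simp add: algebra_simps)
  have "picard (Suc n) t \<omega> - trap_mass t \<omega> = volterra (picard n) t \<omega> - volterra trap_mass t \<omega>"
    using trap_mass_volterra[OF \<omega> Suc.prems] by simp
  also have "\<dots> = \<gamma> * (\<integral>s. indicator {0..t} s * (?K s * (picard n s \<omega> - trap_mass s \<omega>)) \<partial>lborel)"
    unfolding volterra_def split Bochner_Integration.integral_add[OF int int2] by (simp add: algebra_simps)
  finally have "\<bar>picard (Suc n) t \<omega> - trap_mass t \<omega>\<bar>
      = \<bar>\<integral>s. indicator {0..t} s * (?K s * (picard n s \<omega> - trap_mass s \<omega>)) \<partial>lborel\<bar> * \<bar>\<gamma>\<bar>"
    by (simp only: abs_mult mult.commute)
  also have "\<dots> \<le> (\<integral>s. indicator {0..t} s * ((\<bar>\<gamma>\<bar> * s) ^ n / fact n) \<partial>lborel) * \<bar>\<gamma>\<bar>"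
  proof (intro mult_right_mono)
    have "\<bar>\<integral>s. indicator {0..t} s * (?K s * (picard n s \<omega> - trap_mass s \<omega>)) \<partial>lborel\<bar>
        \<le> (\<integral>s. \<bar>indicator {0..t} s * (?K s * (picard n s \<omega> - trap_mass s \<omega>))\<bar> \<partial>lborel)"
      by (rule integral_abs_bound)
    also have "\<dots> \<le> (\<integral>s. indicator {0..t} s * ((\<bar>\<gamma>\<bar> * s) ^ n / fact n) \<partial>lborel)"
    proof (rule integral_mono[OF integrable_abs[OF int2]])
      show "integrable lborel (\<lambda>s. indicator {0..t} s * ((\<bar>\<gamma>\<bar> * s) ^ n / fact n))"
      proof (rule integrable_indicator_Icc_bounded[where B="(\<bar>\<gamma>\<bar> * t) ^ n / fact n"])
        show "\<bar>(\<bar>\<gamma>\<bar> * s) ^ n / fact n\<bar> \<le> (\<bar>\<gamma>\<bar> * t) ^ n / fact n" if "0 \<le> s" "s \<le> t" for s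
          using that by (auto simp: abs_mult intro!: divide_right_mono power_mono mult_left_mono)
      qed measurable
      show "\<bar>indicator {0..t} s * (?K s * (picard n s \<omega> - trap_mass s \<omega>))\<bar> \<le> indicator {0..t} s * ((\<bar>\<gamma>\<bar> * s) ^ n / fact n)" for s
        using diff[of s] by (auto simp: indicator_def)
    qed
    finally show "\<bar>\<integral>s. indicator {0..t} s * (?K s * (picard n s \<omega> - trap_mass s \<omega>)) \<partial>lborel\<bar>
        \<le> (\<integral>s. indicator {0..t} s * ((\<bar>\<gamma>\<bar> * s) ^ n / fact n) \<partial>lborel)" .
  qed simp
  also have "\<dots> = (\<bar>\<gamma>\<bar> * t) ^ Suc n / fact (Suc n)"
    by (rule integral_power_interval[OF Suc.prems])
  finally show ?case .
qed

lemma abs_picard_le: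
  assumes \<omega>: "\<omega> \<in> space M" and "0 \<le> s" "s \<le> t"
  shows "\<bar>picard n s \<omega>\<bar> \<le> 1 + exp (\<bar>\<gamma>\<bar> * t)"
proof -
  have "\<bar>picard n s \<omega> - trap_mass s \<omega>\<bar> \<le> exp (\<bar>\<gamma>\<bar> * s)"
    using picard_error[OF \<omega> assms(2), of n] power_over_fact_le_exp[of "\<bar>\<gamma>\<bar> * s" n] assms by simp
  also have "\<dots> \<le> exp (\<bar>\<gamma>\<bar> * t)" using assms by (simp add: mult_left_mono)
  finally show ?thesis using trap_mass_bounds[OF \<omega>, of s] by linarith
qed

lemma picard_tendsto:
  assumes \<omega>: "\<omega> \<in> space M" and "0 \<le> t"
  shows "(\<lambda>n. picard n t \<omega>) \<longlonglongrightarrow> trap_mass t \<omega>"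
proof -
  have "(\<lambda>n. picard n t \<omega> - trap_mass t \<omega>) \<longlonglongrightarrow> 0"
    by (rule Lim_null_comparison[OF _ power_over_fact_tendsto_0[of "\<bar>\<gamma>\<bar> * t"]])
       (use picard_error[OF assms] in auto)
  thus ?thesis by (simp add: LIM_zero_iff)
qed

lemma trap_mass_max: "trap_mass (max 0 t) \<omega> = trap_mass t \<omega>"
  by (simp add: trap_mass_def X_def)

text \<open>Pointwise limit of the jointly measurable iterates; \<open>max 0\<close> is inserted
  because they converge at nonnegative times.\<close>

lemma measurable_trap_mass [measurable (raw)]:
  assumes f: "f \<in> borel_measurable N" and g: "g \<in> measurable N M"
  shows "(\<lambda>x. trap_mass (f x) (g x)) \<in> borel_measurable N"
proof (rule borel_measurable_LIMSEQ_real)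
  show "(\<lambda>x. picard n (max 0 (f x)) (g x)) \<in> borel_measurable N" for n
    using f g by measurable
  show "(\<lambda>n. picard n (max 0 (f x)) (g x)) \<longlonglongrightarrow> trap_mass (f x) (g x)" if "x \<in> space N" for x
    using picard_tendsto[of "g x" "max 0 (f x)"] measurable_space[OF g that] by (simp add: trap_mass_max)
qed

text \<open>Picard iteration for the deterministic renewal equation; \<open>mean_picard_eq\<close>
  identifies it with the means of the random iterates.\<close>

primrec mean_picard :: "nat \<Rightarrow> real \<Rightarrow> real" where
  "mean_picard 0 t = 0"
| "mean_picard (Suc n) t = heat_kernel ((\<kappa> + \<rho>) * t) z
     + \<gamma> * (\<integral>s. indicator {0..t} s * (heat_kernel ((\<kappa> + \<rho>) * (t - s)) (0 :: int ^ 'd) * mean_picard n s) \<partial>lborel)"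

text \<open>Independence is used through products of functions of increments after time \<open>t = \<tau> 0\<close>:
  prepending the increment over \<open>[s, t]\<close> gives such a product for the earlier time \<open>s\<close>.\<close>

lemma expectation_picard_future:
  assumes \<tau>: "0 \<le> \<tau> 0" "mono \<tau>" and f: "\<And>i x. \<bar>f i x\<bar> \<le> (1 :: real)"
  shows "(\<integral>\<omega>. picard n (\<tau> 0) \<omega> * (\<Prod>i<k. f i (Y (\<tau> (Suc i)) \<omega> - Y (\<tau> i) \<omega>)) \<partial>M)
    = mean_picard n (\<tau> 0) * (\<Prod>i<k. \<integral>\<omega>. f i (Y (\<tau> (Suc i)) \<omega> - Y (\<tau> i) \<omega>) \<partial>M)"
  using assms
proof (induction n arbitrary: \<tau> f k)
  case 0
  thus ?case by simp
next
  case (Suc n \<tau> f k)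
  interpret MP: pair_sigma_finite lborel M ..
  define t where "t = \<tau> 0"
  have t: "0 \<le> t" using Suc.prems by (simp add: t_def)
  define \<Phi> where "\<Phi> \<omega> = (\<Prod>i<k. f i (Y (\<tau> (Suc i)) \<omega> - Y (\<tau> i) \<omega>))" for \<omega>
  define P where "P = (\<Prod>i<k. \<integral>\<omega>. f i (Y (\<tau> (Suc i)) \<omega> - Y (\<tau> i) \<omega>) \<partial>M)"
  have \<tau>_nonneg: "0 \<le> \<tau> i" for i using Suc.prems by (meson le0 monoD order.trans)
  have [measurable]: "\<Phi> \<in> borel_measurable M"
    unfolding \<Phi>_def using \<tau>_nonneg by (intro borel_measurable_prod measurable_increment_fun) auto
  have \<Phi>: "\<bar>\<Phi> \<omega>\<bar> \<le> 1" for \<omega>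
    unfolding \<Phi>_def abs_prod by (rule prod_le_1) (use Suc.prems in auto)
  \<comment> \<open>\<open>case_nat s \<tau>\<close> prepends the earlier time \<open>s\<close> to
    the sequence.\<close>
  have mono': "mono (case_nat s \<tau>)" if "s \<le> t" for s
    using that Suc.prems(2) by (auto simp: mono_iff_le_Suc t_def split: nat.splits)
  have shift: "(\<Prod>i<Suc k. g i) = g 0 * (\<Prod>i<k. g (Suc i))" for g :: "nat \<Rightarrow> real"
    by (rule prod.lessThan_Suc_shift)
  let ?K = "\<lambda>s \<omega>. heat_kernel (\<kappa> * (t - s)) (X s \<omega> - X t \<omega>)"
  have bK: "\<bar>heat_kernel (\<kappa> * (t - s)) x\<bar> \<le> 1" if "s \<le> t" for s and x :: "int ^ 'd"
    using that \<kappa> by (intro abs_heat_kernel_le_1) auto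
  have EK: "(\<integral>\<omega>. heat_kernel (\<kappa> * (t - s)) (x - (Y t \<omega> - Y s \<omega>)) \<partial>M) = heat_kernel ((\<kappa> + \<rho>) * (t - s)) x"
    if "0 \<le> s" "s \<le> t" for s x
  proof -
    have "(\<integral>\<omega>. heat_kernel (\<kappa> * (t - s)) (x - (Y t \<omega> - Y s \<omega>)) \<partial>M)
        = (\<integral>\<omega>. heat_kernel (\<kappa> * (t - s)) (- x + (Y t \<omega> - Y s \<omega>)) \<partial>M)"
      by (intro Bochner_Integration.integral_cong refl) (subst heat_kernel_minus[symmetric], simp)
    also have "\<dots> = heat_kernel ((\<kappa> + \<rho>) * (t - s)) x"
      using \<rho> that by (subst expectation_heat_kernel_walk) (auto simp: distrib_right)
    finally show ?thesis .
  qed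
  have first: "(\<integral>\<omega>. heat_kernel (\<kappa> * t) (z - X t \<omega>) * \<Phi> \<omega> \<partial>M) = heat_kernel ((\<kappa> + \<rho>) * t) z * P"
  proof -
    \<comment> \<open>Since the trap starts at the origin, its position at time \<open>t\<close> is
      the increment over [0, t]; the free term is therefore a plain product of increments.\<close>
    let ?g = "case_nat (\<lambda>x. heat_kernel (\<kappa> * (t - 0)) (z - x)) f"
    have "(\<integral>\<omega>. heat_kernel (\<kappa> * t) (z - X t \<omega>) * \<Phi> \<omega> \<partial>M)
        = (\<integral>\<omega>. (\<Prod>i<Suc k. ?g i (Y (case_nat 0 \<tau> (Suc i)) \<omega> - Y (case_nat 0 \<tau> i) \<omega>)) \<partial>M)"
      unfolding shift using t
      by (intro Bochner_Integration.integral_cong refl)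
         (simp add: \<Phi>_def walk_start X_nonneg t_def[symmetric])
    also have "\<dots> = (\<Prod>i<Suc k. \<integral>\<omega>. ?g i (Y (case_nat 0 \<tau> (Suc i)) \<omega> - Y (case_nat 0 \<tau> i) \<omega>) \<partial>M)"
      by (rule expectation_prod_increments[where B=1])
         (use mono' t bK[of 0] Suc.prems(3) in \<open>auto split: nat.splits\<close>)
    also have "\<dots> = heat_kernel ((\<kappa> + \<rho>) * t) z * P"
      unfolding shift using t EK[of 0 z] by (simp add: P_def t_def[symmetric])
    finally show ?thesis .
  qed
  have second: "(\<integral>\<omega>. picard n s \<omega> * (?K s \<omega> * \<Phi> \<omega>) \<partial>M) = mean_picard n s * (heat_kernel ((\<kappa> + \<rho>) * (t - s)) (0 :: int ^ 'd) * P)"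
    if s: "0 \<le> s" "s \<le> t" for s
  proof -
    \<comment> \<open>The kernel at \<open>X s - X t\<close> depends only on the increment over
      [s, t]. It becomes the first factor after time \<open>s\<close>, and the induction hypothesis
      applies to the longer product.\<close>
    let ?g = "case_nat (\<lambda>x. heat_kernel (\<kappa> * (t - s)) (0 - x)) f"
    have "(\<integral>\<omega>. picard n s \<omega> * (?K s \<omega> * \<Phi> \<omega>) \<partial>M)
        = (\<integral>\<omega>. picard n (case_nat s \<tau> 0) \<omega> * (\<Prod>i<Suc k. ?g i (Y (case_nat s \<tau> (Suc i)) \<omega> - Y (case_nat s \<tau> i) \<omega>)) \<partial>M)"
      unfolding shift using t s
      by (intro Bochner_Integration.integral_cong refl) (simp add: \<Phi>_def X_nonneg t_def[symmetric] heat_kernel_commute)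
    also have "\<dots> = mean_picard n (case_nat s \<tau> 0) * (\<Prod>i<Suc k. \<integral>\<omega>. ?g i (Y (case_nat s \<tau> (Suc i)) \<omega> - Y (case_nat s \<tau> i) \<omega>) \<partial>M)"
      by (rule Suc.IH) (use mono' s bK Suc.prems(3) in \<open>auto split: nat.splits\<close>)
    also have "\<dots> = mean_picard n s * (heat_kernel ((\<kappa> + \<rho>) * (t - s)) (0 :: int ^ 'd) * P)"
      unfolding shift using EK[OF s, of 0] by (simp add: P_def t_def[symmetric] heat_kernel_commute)
    finally show ?thesis .
  qed
  let ?h = "\<lambda>s \<omega>. indicator {0..t} s * (?K s \<omega> * picard n s \<omega> * \<Phi> \<omega>)"
  have int: "integrable (lborel \<Otimes>\<^sub>M M) (case_prod ?h)"
  proof -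
    \<comment> \<open>The set has finite product measure, and its second factor
      \<open>space M\<close> is where the bound on the iterates holds.\<close>
    have "integrable (lborel \<Otimes>\<^sub>M M) (\<lambda>p. indicator ({0..t} \<times> space M) p *\<^sub>R (?K (fst p) (snd p) * picard n (fst p) (snd p) * \<Phi> (snd p)))"
    proof (rule integrableI_bounded_set_indicator[where B="1 * (1 + exp (\<bar>\<gamma>\<bar> * t)) * 1"])
      show "emeasure (lborel \<Otimes>\<^sub>M M) ({0..t} \<times> space M) < \<infinity>"
        using t by (subst emeasure_pair_measure_Times) (auto simp: emeasure_space_1)
      show "AE p in lborel \<Otimes>\<^sub>M M. p \<in> {0..t} \<times> space M \<longrightarrow>
          norm (?K (fst p) (snd p) * picard n (fst p) (snd p) * \<Phi> (snd p)) \<le> 1 * (1 + exp (\<bar>\<gamma>\<bar> * t)) * 1"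
        unfolding real_norm_def abs_mult
        by (intro AE_I2 impI mult_mono abs_picard_le \<Phi> bK) auto
    qed measurable
    also have "?this \<longleftrightarrow> ?thesis"
      by (intro Bochner_Integration.integrable_cong refl) (auto simp: indicator_def space_pair_measure)
    finally show ?thesis .
  qed
  have "(\<integral>\<omega>. picard (Suc n) t \<omega> * \<Phi> \<omega> \<partial>M)
      = (\<integral>\<omega>. heat_kernel (\<kappa> * t) (z - X t \<omega>) * \<Phi> \<omega> + \<gamma> * (\<integral>s. ?h s \<omega> \<partial>lborel) \<partial>M)"
    by (intro Bochner_Integration.integral_cong refl)
       (simp add: volterra_def distrib_right mult.assoc Bochner_Integration.integral_mult_left_zero[symmetric])
  also have "\<dots> = (\<integral>\<omega>. heat_kernel (\<kappa> * t) (z - X t \<omega>) * \<Phi> \<omega> \<partial>M) + \<gamma> * (\<integral>\<omega>. (\<integral>s. ?h s \<omega> \<partial>lborel) \<partial>M)"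
  proof (subst Bochner_Integration.integral_add)
    show "integrable M (\<lambda>\<omega>. heat_kernel (\<kappa> * t) (z - X t \<omega>) * \<Phi> \<omega>)"
    proof (rule integrable_const_bound[where B="1 * 1"])
      show "AE \<omega> in M. norm (heat_kernel (\<kappa> * t) (z - X t \<omega>) * \<Phi> \<omega>) \<le> 1 * 1"
        unfolding real_norm_def abs_mult using bK[of 0] t by (intro AE_I2 mult_mono \<Phi>) auto
    qed measurable
    show "integrable M (\<lambda>\<omega>. \<gamma> * (\<integral>s. ?h s \<omega> \<partial>lborel))"
      by (intro integrable_mult_right MP.integrable_snd int)
  qed simp
  also have "(\<integral>\<omega>. (\<integral>s. ?h s \<omega> \<partial>lborel) \<partial>M) = (\<integral>s. (\<integral>\<omega>. ?h s \<omega> \<partial>M) \<partial>lborel)"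
    by (rule MP.Fubini_integral[OF int])
  also have "\<dots> = (\<integral>s. indicator {0..t} s * (heat_kernel ((\<kappa> + \<rho>) * (t - s)) (0 :: int ^ 'd) * mean_picard n s) * P \<partial>lborel)"
  proof (intro Bochner_Integration.integral_cong refl)
    fix s :: real
    show "(\<integral>\<omega>. ?h s \<omega> \<partial>M) = indicator {0..t} s * (heat_kernel ((\<kappa> + \<rho>) * (t - s)) (0 :: int ^ 'd) * mean_picard n s) * P"
      using second[of s] by (auto simp: indicator_def mult_ac)
  qed
  also have "\<dots> = (\<integral>s. indicator {0..t} s * (heat_kernel ((\<kappa> + \<rho>) * (t - s)) (0 :: int ^ 'd) * mean_picard n s) \<partial>lborel) * P"
    by (rule integral_mult_left_zero)
  finally show ?case
    unfolding first by (simp add: \<Phi>_def P_def t_def distrib_right[of _ _ "prod _ _"] mult.assoc del: picard.simps)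
qed

definition mean_trap_mass :: "real \<Rightarrow> real" where
  "mean_trap_mass t = (\<integral>\<omega>. trap_mass t \<omega> \<partial>M)"

text \<open>The case of an empty product of later increments.\<close>

lemma mean_picard_eq:
  assumes "0 \<le> t" shows "mean_picard n t = (\<integral>\<omega>. picard n t \<omega> \<partial>M)"
  using expectation_picard_future[of "\<lambda>_. t" "\<lambda>_ _. 1" n 0] assms by (simp add: mono_def)

lemma abs_mean_picard_le:
  assumes "0 \<le> s" "s \<le> t"
  shows "\<bar>mean_picard n s\<bar> \<le> 1 + exp (\<bar>\<gamma>\<bar> * t)"
proof -
  have "\<bar>mean_picard n s\<bar> \<le> (\<integral>\<omega>. \<bar>picard n s \<omega>\<bar> \<partial>M)"
    unfolding mean_picard_eq[OF assms(1)] by (rule integral_abs_bound)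
  also have "\<dots> \<le> (\<integral>\<omega>. 1 + exp (\<bar>\<gamma>\<bar> * t) \<partial>M)"
    using abs_picard_le[OF _ assms]
    by (intro integral_mono integrable_const_bound[where B="1 + exp (\<bar>\<gamma>\<bar> * t)"] AE_I2) auto
  finally show ?thesis by (simp add: prob_space)
qed

lemma mean_picard_tendsto:
  assumes "0 \<le> t" shows "(\<lambda>n. mean_picard n t) \<longlonglongrightarrow> mean_trap_mass t"
  unfolding mean_picard_eq[OF assms] mean_trap_mass_def
proof (rule integral_dominated_convergence[where w="\<lambda>_. 1 + exp (\<bar>\<gamma>\<bar> * t)"])
  show "AE \<omega> in M. (\<lambda>n. picard n t \<omega>) \<longlonglongrightarrow> trap_mass t \<omega>"
    using assms by (intro AE_I2 picard_tendsto)
  show "AE \<omega> in M. norm (picard n t \<omega>) \<le> 1 + exp (\<bar>\<gamma>\<bar> * t)" for n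
    using abs_picard_le[OF _ assms order.refl] by (intro AE_I2) auto
qed auto

lemma mean_trap_mass_nonneg: "0 \<le> mean_trap_mass t"
  unfolding mean_trap_mass_def by (rule Bochner_Integration.integral_nonneg) (rule trap_mass_bounds)

lemma mean_trap_mass_le_1: "mean_trap_mass t \<le> 1"
proof -
  have "mean_trap_mass t \<le> (\<integral>\<omega>. 1 \<partial>M)"
    unfolding mean_trap_mass_def using trap_mass_bounds
    by (intro integral_mono integrable_const_bound[where B=1] AE_I2) auto
  thus ?thesis by (simp add: prob_space)
qed

lemma measurable_mean_trap_mass [measurable]: "mean_trap_mass \<in> borel_measurable borel"
  unfolding mean_trap_mass_def by measurable

text \<open>Limit of the recursion for \<open>mean_picard\<close>; the bound 1 + exp(|\<gamma>|t),
  uniform in the iteration index on [0, t], dominates.\<close>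

theorem renewal_equation:
  assumes t: "0 \<le> t"
  shows "mean_trap_mass t = heat_kernel ((\<kappa> + \<rho>) * t) z
     + \<gamma> * (\<integral>s. indicator {0..t} s * (heat_kernel ((\<kappa> + \<rho>) * (t - s)) (0 :: int ^ 'd) * mean_trap_mass s) \<partial>lborel)"
proof -
  let ?h = "\<lambda>f s. indicator {0..t} s * (heat_kernel ((\<kappa> + \<rho>) * (t - s)) (0 :: int ^ 'd) * f s)"
  have [measurable]: "(\<lambda>s. mean_picard n (max 0 s)) \<in> borel_measurable borel" for n
    by (subst mean_picard_eq) (auto, measurable)
  have "(\<lambda>n. \<integral>s. ?h (mean_picard n) s \<partial>lborel) \<longlonglongrightarrow> (\<integral>s. ?h mean_trap_mass s \<partial>lborel)"
  proof (rule integral_dominated_convergence[where w="\<lambda>s. indicator {0..t} s * (1 + exp (\<bar>\<gamma>\<bar> * t))"])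
    show "integrable lborel (\<lambda>s. indicator {0..t} s * (1 + exp (\<bar>\<gamma>\<bar> * t)))"
      by (rule integrable_indicator_Icc_bounded[where B="1 + exp (\<bar>\<gamma>\<bar> * t)"]) auto
    \<comment> \<open>Measurability of \<open>mean_picard\<close> was obtained through its agreement
      with means at nonnegative times; the indicator hides the rest.\<close>
    have "?h (mean_picard n) = ?h (\<lambda>s. mean_picard n (max 0 s))" for n
      by (auto simp: indicator_def fun_eq_iff)
    thus "?h (mean_picard n) \<in> borel_measurable lborel" for n by simp
    show "AE s in lborel. (\<lambda>n. ?h (mean_picard n) s) \<longlonglongrightarrow> ?h mean_trap_mass s"
      by (rule AE_I2) (auto simp: indicator_def intro!: tendsto_intros mean_picard_tendsto)
    show "AE s in lborel. norm (?h (mean_picard n) s) \<le> indicator {0..t} s * (1 + exp (\<bar>\<gamma>\<bar> * t))" for n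
    proof (rule AE_I2)
      fix s
      have "\<bar>heat_kernel ((\<kappa> + \<rho>) * (t - s)) (0 :: int ^ 'd) * mean_picard n s\<bar> \<le> 1 * (1 + exp (\<bar>\<gamma>\<bar> * t))"
        if "0 \<le> s" "s \<le> t"
        unfolding abs_mult using that \<kappa> \<rho>
        by (intro mult_mono abs_heat_kernel_le_1 abs_mean_picard_le) auto
      thus "norm (?h (mean_picard n) s) \<le> indicator {0..t} s * (1 + exp (\<bar>\<gamma>\<bar> * t))"
        by (auto simp: indicator_def)
    qed
  qed measurable
  hence "(\<lambda>n. mean_picard (Suc n) t) \<longlonglongrightarrow> heat_kernel ((\<kappa> + \<rho>) * t) z + \<gamma> * (\<integral>s. ?h mean_trap_mass s \<partial>lborel)"
    by (auto intro!: tendsto_intros)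
  thus ?thesis
    using LIMSEQ_Suc[OF mean_picard_tendsto[OF t]] LIMSEQ_unique by blast
qed

section \<open>Expected total mass and its limit\<close>

lemma expectation_total_mass:
  assumes T: "0 \<le> T"
  shows "(\<integral>\<omega>. (\<Sum>\<^sub>\<infinity>x\<in>UNIV. u \<omega> T x) \<partial>M) = 1 + \<gamma> * (LINT t:{0..T}|lborel. mean_trap_mass t)"
proof -
  interpret MP: pair_sigma_finite lborel M ..
  have int: "integrable (lborel \<Otimes>\<^sub>M M) (\<lambda>(t, \<omega>). indicator {0..T} t * trap_mass t \<omega>)"
  proof -
    have "integrable (lborel \<Otimes>\<^sub>M M) (\<lambda>p. indicator ({0..T} \<times> space M) p *\<^sub>R trap_mass (fst p) (snd p))"
    proof (rule integrableI_bounded_set_indicator[where B="1"])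
      show "emeasure (lborel \<Otimes>\<^sub>M M) ({0..T} \<times> space M) < \<infinity>"
        using T by (subst emeasure_pair_measure_Times) (auto simp: emeasure_space_1)
      show "AE p in lborel \<Otimes>\<^sub>M M. p \<in> {0..T} \<times> space M \<longrightarrow> norm (trap_mass (fst p) (snd p)) \<le> 1"
        using trap_mass_bounds by (intro AE_I2) auto
    qed measurable
    also have "?this \<longleftrightarrow> ?thesis"
      by (intro Bochner_Integration.integrable_cong refl) (auto simp: indicator_def space_pair_measure)
    finally show ?thesis .
  qed
  have "(\<integral>\<omega>. (\<Sum>\<^sub>\<infinity>x\<in>UNIV. u \<omega> T x) \<partial>M) = (\<integral>\<omega>. 1 + \<gamma> * (\<integral>t. indicator {0..T} t * trap_mass t \<omega> \<partial>lborel) \<partial>M)"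
  proof (intro Bochner_Integration.integral_cong refl)
    fix \<omega> assume "\<omega> \<in> space M"
    then interpret pam_path \<kappa> \<gamma> "\<lambda>t. Y t \<omega>" z "u \<omega>" by (rule pam_path)
    show "(\<Sum>\<^sub>\<infinity>x\<in>UNIV. u \<omega> T x) = 1 + \<gamma> * (\<integral>t. indicator {0..T} t * trap_mass t \<omega> \<partial>lborel)"
      using has_sum_u[OF T] by (intro infsumI) (simp add: trap_mass_def X_def)
  qed
  also have "\<dots> = 1 + \<gamma> * (\<integral>\<omega>. (\<integral>t. indicator {0..T} t * trap_mass t \<omega> \<partial>lborel) \<partial>M)"
    using MP.integrable_snd[OF int] by (simp add: prob_space)
  also have "(\<integral>\<omega>. (\<integral>t. indicator {0..T} t * trap_mass t \<omega> \<partial>lborel) \<partial>M) = (\<integral>t. (\<integral>\<omega>. indicator {0..T} t * trap_mass t \<omega> \<partial>M) \<partial>lborel)"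
    by (rule MP.Fubini_integral[OF int])
  also have "\<dots> = (LINT t:{0..T}|lborel. mean_trap_mass t)"
    by (simp add: set_lebesgue_integral_def mean_trap_mass_def)
  finally show ?thesis .
qed

text \<open>With the \<gamma> term on the left every term is nonnegative. Integration over time
  turns the convolution into a product by Tonelli, leaving for I, the integral of
  \<open>mean_trap_mass\<close>, the linear equation I - \<gamma> I G(0)/c = G(z)/c with c =
  \<kappa> + \<rho>.\<close>

lemma integral_mean_trap_mass:
  assumes d: "CARD('d) \<ge> 3"
  defines "G \<equiv> \<lambda>x :: int ^ 'd. LINT t:{0..}|lborel. heat_kernel t x"
  shows "set_integrable lborel {0..} mean_trap_mass"
    and "(LINT t:{0..}|lborel. mean_trap_mass t) = G z / (\<kappa> + \<rho> - \<gamma> * G 0)"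
proof -
  define c where "c = \<kappa> + \<rho>"
  have c: "c > 0" using \<kappa> \<rho> by (simp add: c_def)
  have K_nonneg: "heat_kernel (c * t) x \<ge> 0" if "t \<ge> 0" for t and x :: "int ^ 'd"
    using heat_kernel_nonneg[OF \<rho>, of "c * t" x] that c by simp
  have G: "(\<integral>\<^sup>+t. ennreal (indicator {0..} t * heat_kernel (c * t) x) \<partial>lborel) = ennreal (G x / c)"
    and G_nonneg: "G x \<ge> 0" for x
  proof -
    have "integrable lborel (\<lambda>t. indicator {0..} t * heat_kernel (c * t) x)"
      using integrable_heat_kernel[OF d c, of x] by (simp add: set_integrable_def)
    hence "(\<integral>\<^sup>+t. ennreal (indicator {0..} t * heat_kernel (c * t) x) \<partial>lborel) = ennreal (\<integral>t. indicator {0..} t * heat_kernel (c * t) x \<partial>lborel)"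
      by (rule nn_integral_eq_integral) (auto simp: indicator_def intro: K_nonneg)
    also have "(\<integral>t. indicator {0..} t * heat_kernel (c * t) x \<partial>lborel) = G x / c"
      using integral_heat_kernel_scale[OF c, of x] by (simp add: set_lebesgue_integral_def G_def)
    finally show "(\<integral>\<^sup>+t. ennreal (indicator {0..} t * heat_kernel (c * t) x) \<partial>lborel) = ennreal (G x / c)" .
    show "G x \<ge> 0" unfolding G_def set_lebesgue_integral_def
      by (rule Bochner_Integration.integral_nonneg) (auto simp: indicator_def intro: heat_kernel_nonneg[OF \<rho>])
  qed
  let ?g = mean_trap_mass
  define I where "I = (\<integral>\<^sup>+t. ennreal (indicator {0..} t * ?g t) \<partial>lborel)"
  let ?h = "\<lambda>t s. if 0 \<le> s \<and> s \<le> t then heat_kernel (c * (t - s)) (0 :: int ^ 'd) * ?g s else 0"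
  have h_nonneg: "?h t s \<ge> 0" for t s
    by (auto intro!: mult_nonneg_nonneg K_nonneg mean_trap_mass_nonneg)
  have eq: "ennreal (indicator {0..} t * ?g t) + ennreal (- \<gamma>) * (\<integral>\<^sup>+s. ennreal (?h t s) \<partial>lborel)
      = ennreal (indicator {0..} t * heat_kernel (c * t) z)" for t
  proof (cases "t \<ge> 0")
    case True
    have hh: "?h t s = indicator {0..t} s * (heat_kernel (c * (t - s)) (0 :: int ^ 'd) * ?g s)" for s
      by (auto simp: indicator_def)
    have "integrable lborel (?h t)"
      unfolding hh
    proof (rule integrable_indicator_Icc_bounded[where B="1 * 1"])
      show "\<bar>heat_kernel (c * (t - s)) (0 :: int ^ 'd) * ?g s\<bar> \<le> 1 * 1" if "0 \<le> s" "s \<le> t" for s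
        unfolding abs_mult using that c mean_trap_mass_nonneg[of s] mean_trap_mass_le_1[of s]
        by (intro mult_mono abs_heat_kernel_le_1) auto
    qed measurable
    hence "(\<integral>\<^sup>+s. ennreal (?h t s) \<partial>lborel) = ennreal (\<integral>s. ?h t s \<partial>lborel)"
      by (rule nn_integral_eq_integral) (use h_nonneg in auto)
    moreover have "?g t + - \<gamma> * (\<integral>s. ?h t s \<partial>lborel) = heat_kernel (c * t) z"
      unfolding hh using renewal_equation[OF True] by (simp add: c_def)
    moreover have "(\<integral>s. ?h t s \<partial>lborel) \<ge> 0" by (rule Bochner_Integration.integral_nonneg) (rule h_nonneg)
    ultimately show ?thesis
      using True \<gamma> mean_trap_mass_nonneg[of t]
      by (simp add: ennreal_mult'[symmetric] ennreal_plus[symmetric] mult_nonpos_nonneg del: ennreal_plus)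
  next
    case False
    hence "?h t s = 0" for s by auto
    thus ?thesis using False by simp
  qed
  have meas: "(\<lambda>(t, s). ennreal (?h t s)) \<in> borel_measurable (lborel \<Otimes>\<^sub>M lborel)"
    by measurable
  have inner: "(\<integral>\<^sup>+t. ennreal (?h t s) \<partial>lborel) = ennreal (indicator {0..} s * ?g s) * ennreal (G 0 / c)" for s
  proof (cases "s \<ge> 0")
    case True
    \<comment> \<open>Translation by \<open>s\<close> turns the constraint s \<le> t into t \<ge> 0,
      so the inner integral is the Green's function at 0 times the value at
      \<open>s\<close>.\<close>
    have "(\<integral>\<^sup>+t. ennreal (?h t s) \<partial>lborel) = ennreal \<bar>1\<bar> * (\<integral>\<^sup>+t. ennreal (?h (s + 1 * t) s) \<partial>lborel)"
      by (rule nn_integral_real_affine) auto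
    also have "(\<integral>\<^sup>+t. ennreal (?h (s + 1 * t) s) \<partial>lborel) = (\<integral>\<^sup>+t. ennreal (?g s) * ennreal (indicator {0..} t * heat_kernel (c * t) (0 :: int ^ 'd)) \<partial>lborel)"
      using True mean_trap_mass_nonneg[of s]
      by (intro nn_integral_cong) (auto simp: indicator_def ennreal_mult'[symmetric] mult.commute)
    also have "\<dots> = ennreal (?g s) * ennreal (G 0 / c)"
      by (simp add: nn_integral_cmult G)
    finally show ?thesis using True by simp
  qed simp
  have "(\<integral>\<^sup>+t. (\<integral>\<^sup>+s. ennreal (?h t s) \<partial>lborel) \<partial>lborel) = (\<integral>\<^sup>+s. (\<integral>\<^sup>+t. ennreal (?h t s) \<partial>lborel) \<partial>lborel)"
    by (rule lborel_pair.Fubini'[OF meas, symmetric])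
  also have "\<dots> = I * ennreal (G 0 / c)"
    unfolding inner I_def by (rule nn_integral_multc) measurable
  finally have double: "(\<integral>\<^sup>+t. (\<integral>\<^sup>+s. ennreal (?h t s) \<partial>lborel) \<partial>lborel) = I * ennreal (G 0 / c)" .
  have "ennreal (G z / c) = (\<integral>\<^sup>+t. ennreal (indicator {0..} t * ?g t) + ennreal (- \<gamma>) * (\<integral>\<^sup>+s. ennreal (?h t s) \<partial>lborel) \<partial>lborel)"
    unfolding eq G ..
  also have "\<dots> = I + ennreal (- \<gamma>) * (I * ennreal (G 0 / c))"
    unfolding I_def double[unfolded I_def, symmetric]
    by (subst nn_integral_add) (auto simp: nn_integral_cmult)
  finally have I_eq: "I + ennreal (- \<gamma>) * (I * ennreal (G 0 / c)) = ennreal (G z / c)" ..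
  \<comment> \<open>\<open>I\<close> is a summand of a finite sum in \<open>ennreal\<close>; this is
    where integrability is first obtained.\<close>
  hence "I \<noteq> \<infinity>" by auto
  then obtain i where i: "I = ennreal i" "i \<ge> 0" by (cases I) auto
  have "ennreal (i + - \<gamma> * (i * (G 0 / c))) = ennreal (G z / c)"
    using I_eq i \<gamma> G_nonneg[of 0] c
    by (simp add: ennreal_mult'[symmetric] ennreal_plus[symmetric] mult_nonpos_nonneg divide_nonpos_pos del: ennreal_plus)
  moreover have "i + - \<gamma> * (i * (G 0 / c)) \<ge> 0"
    using i \<gamma> G_nonneg[of 0] c by (intro add_nonneg_nonneg mult_nonneg_nonneg divide_nonneg_pos) auto
  ultimately have "i + - \<gamma> * (i * (G 0 / c)) = G z / c"
    using G_nonneg[of z] c by (subst (asm) ennreal_inj) auto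
  moreover have "c - \<gamma> * G 0 > 0"
    using c \<gamma> G_nonneg[of 0] mult_nonpos_nonneg[of \<gamma> "G 0"] by linarith
  ultimately have i_eq: "i = G z / (\<kappa> + \<rho> - \<gamma> * G 0)"
    unfolding c_def[symmetric] using c by (simp add: field_simps)
  have nonneg: "0 \<le> indicator {0..} t * ?g t" for t by (simp add: mean_trap_mass_nonneg)
  show int: "set_integrable lborel {0..} ?g"
    unfolding set_integrable_def using i I_def nonneg by (intro integrableI_nonneg) auto
  have "(LINT t:{0..}|lborel. ?g t) = enn2real I"
    unfolding set_lebesgue_integral_def I_def using nonneg by (simp add: integral_eq_nn_integral)
  thus "(LINT t:{0..}|lborel. ?g t) = G z / (\<kappa> + \<rho> - \<gamma> * G 0)"
    using i i_eq by simp
qed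

end

theorem theorem2:
  fixes M :: "'w measure" and N :: "'v measure"
    and Y :: "real \<Rightarrow> 'w \<Rightarrow> int ^ 'd" and Z :: "real \<Rightarrow> 'v \<Rightarrow> int ^ 'd"
    and u :: "'w \<Rightarrow> real \<Rightarrow> int ^ 'd \<Rightarrow> real"
    and \<kappa> \<rho> \<gamma> :: real and z :: "int ^ 'd"
  assumes "CARD('d) \<ge> 3"
    and "\<kappa> > 0" and "\<rho> > 0" and "\<gamma> < 0"
    and "lattice_walk M \<rho> 0 Y"
    and "lattice_walk N 1 0 Z"
    and "\<And>\<omega>. \<omega> \<in> space M \<Longrightarrow>
           pam_solution \<kappa> (\<lambda>t x. \<gamma> * lattice_delta (Y t \<omega>) x) (lattice_delta z) (u \<omega>)"
  shows "((\<lambda>t. \<integral>\<omega>. (\<Sum>\<^sub>\<infinity>x\<in>UNIV. u \<omega> t x) \<partial>M) \<longlongrightarrow>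
           1 + \<gamma> / (\<kappa> + \<rho> - \<gamma> * green_function N Z 0) * green_function N Z z) at_top"
proof -
  interpret prob_space M using assms(5) by (simp add: lattice_walk_def)
  interpret pam M \<rho> Y \<kappa> \<gamma> z u by unfold_locales (use assms in auto)
  note green = green_function_eq[OF assms(6)]
  \<comment> \<open>Integrability on the half-line makes the integrals over [0, T] converge.\<close>
  have "((\<lambda>T. 1 + \<gamma> * (LINT t:{0..T}|lborel. mean_trap_mass t)) \<longlongrightarrow>
      1 + \<gamma> * (LINT t:{0..}|lborel. mean_trap_mass t)) at_top"
    by (intro tendsto_intros tendsto_set_lebesgue_integral_at_top integral_mean_trap_mass assms(1)) auto
  also have "1 + \<gamma> * (LINT t:{0..}|lborel. mean_trap_mass t)
      = 1 + \<gamma> / (\<kappa> + \<rho> - \<gamma> * green_function N Z 0) * green_function N Z z"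
    unfolding integral_mean_trap_mass(2)[OF assms(1)] green by simp
  \<comment> \<open>The formula for the expected mass holds at nonnegative times, hence
    eventually.\<close>
  finally show ?thesis
    by (rule Lim_transform_eventually)
       (auto simp: expectation_total_mass intro: eventually_mono[OF eventually_ge_at_top[of 0]])
qed

end
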